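(* Let $m\ge2$. The normalized scaling limit pair correlation function of simultaneous zeros in codimension $2$ on $m$-dimensional manifolds satisfies, for distinct $z^1,z^2\in\mathbb C^m$, $\widetilde K^\infty_{22m}(z^1,z^2)=\kappa_{2m}(|z^1-z^2|)$, where, with $u=r^2$, $$\kappa_{2m}(r)=\frac{(m^2-m)e^{2u}+2(m-1)e^u+2}{(e^u-1)^2m(m-1)}-\frac{4ue^u[(m-1)e^u+1](m+1)}{(e^u-1)^3(m-1)m^2}+\frac{2u^2e^u[(m-1)e^{2u}+2me^u+1]}{(e^u-1)^4(m-1)m^2}.$$
   Context: The scaling limit pair correlation function is $K^\infty_{22m}(z^1,z^2)=\lim_{N\to\infty}N^{-4}K^N_{22}(z^1/\sqrt N,z^2/\sqrt N)$ for distinct $z^1,z^2\in\mathbb C^m$. Here $K^N_{22}$ is the density (with respect to product Riemannian volume on pairs of distinct points) of $\mathbf E(|Z_s|\times|Z_s|)$, where $|Z_s|$ is the Riemannian $(2m-4)$-volume measure on the common zero set of a pair $s=(s_1,s_2)$ of independent Gaussian random sections of $L^N$ and $(L,h)\to M$ is a positive Hermitian line bundle over a compact $m$-dimensional complex manifold with Kähler form $\omega=\frac i2\Theta_h$, $\Theta_h=-\partial\bar\partial\log\|e_L\|_h^2$. The Gaussian measure on $H^0(M,L^N)$ is the standard one for the inner product $\int_Mh^N(s_1,s_2)\,\omega^m/m!$, and the coordinates are centered at a point $z^0$ with $\omega(z^0)=\frac i2\sum dz_q\wedge d\bar z_q$. The limit does not depend on $M,L,h,z^0$. Explicitly, $$K^\infty_{22m}(z^1,z^2)=\frac1{\pi^{4}\det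 A}\Big\langle\det(a^1a^{1*})\det(a^2a^{2*})\Big\rangle_\Lambda,\qquad\Lambda=C-B^*A^{-1}B,$$ where $a^p=(a^p_{jq})$ are complex $2\times m$ matrices. $\langle\cdot\rangle_\Lambda$ is expectation for the centered complex Gaussian vector $(a^p_{jq})$ with $\mathbf E(a^p_{jq}a^{p'}_{j'q'})=0$ and $\mathbf E(a^p_{jq}\overline{a^{p'}_{j'q'}})=\Lambda^{jpq}_{j'p'q'}$. The matrices have entries $A^{jp}_{j'p'}=\delta_{jj'}e^{z^p\cdot\bar z^{p'}}$, $B^{jp}_{j'p'q'}=\delta_{jj'}z^p_{q'}e^{z^p\cdot\bar z^{p'}}$, $C^{jpq}_{j'p'q'}=\delta_{jj'}(\delta_{qq'}+\bar z^{p'}_qz^p_{q'})e^{z^p\cdot\bar z^{p'}}$ (unprimed indices for rows, primed for columns; $j,j',p,p'\in\{1,2\}$, $1\le q,q'\le m$), with $z\cdot\bar w=\sum_qz_q\bar w_q$. Normalization: $\widetilde K^\infty_{22m}=\left(\frac{\pi^2}{m(m-1)}\right)^2K^\infty_{22m}$ (division by the square of the constant one-point function $K^\infty_{12m}=m(m-1)/\pi^2$). *)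

theory Defs
  imports "HOL-Probability.Probability"
begin

section \<open>Centered complex Gaussian vectors\<close>

definition ctranspose :: "complex ^ 'c ^ 'r \<Rightarrow> complex ^ 'r ^ 'c"  (* conjugate transpose *)
  where "ctranspose A = (\<chi> i j. cnj (A $ j $ i))"

text \<open>
  Joint Gaussianity is expressed through real linear functionals. On the complex vector space these
  are exactly the maps \<open>x \<mapsto> Re (\<Sum>i. c i * x i)\<close>. A functional may be degenerate, so the law need
  not have a density.
\<close>

definition centered_gaussian_law :: "(complex ^ 'i) measure \<Rightarrow> bool" where
  "centered_gaussian_law \<mu> \<longleftrightarrow>
     prob_space \<mu> \<and> sets \<mu> = sets borel \<and>
     (\<forall>c :: complex ^ 'i.
        (AE x in \<mu>. Re (\<Sum>i\<in>UNIV. c $ i * x $ i) = 0) \<or>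
        (\<exists>\<sigma>>0. distributed \<mu> lborel (\<lambda>x. Re (\<Sum>i\<in>UNIV. c $ i * x $ i))
                   (\<lambda>t. ennreal (normal_density 0 \<sigma> t))))"

definition complex_gaussian_law :: "complex ^ 'i ^ 'i \<Rightarrow> (complex ^ 'i) measure \<Rightarrow> bool" where
  "complex_gaussian_law \<Lambda> \<mu> \<longleftrightarrow>
     centered_gaussian_law \<mu> \<and>
     (\<forall>i i'. (\<integral>x. x $ i * x $ i' \<partial>\<mu>) = 0) \<and>
     (\<forall>i i'. (\<integral>x. x $ i * cnj (x $ i') \<partial>\<mu>) = \<Lambda> $ i $ i')"

text \<open>
  The law is determined by \<open>\<Lambda>\<close> (it has a prescribed characteristic function) and exists whenever
  \<open>\<Lambda>\<close> is Hermitian and positive semidefinite, so the choice below is immaterial. For any other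
  \<open>\<Lambda>\<close> the value is unspecified.
\<close>

definition complex_gaussian :: "complex ^ 'i ^ 'i \<Rightarrow> (complex ^ 'i) measure" where
  "complex_gaussian \<Lambda> = (SOME \<mu>. complex_gaussian_law \<Lambda> \<mu>)"

section \<open>The scaling limit pair correlation function in codimension two\<close>

definition hdot :: "complex ^ 'm \<Rightarrow> complex ^ 'm \<Rightarrow> complex"
  where "hdot z w = (\<Sum>q\<in>UNIV. z $ q * cnj (w $ q))"

text \<open>
  The labels \<open>j\<close> (section) and \<open>p\<close> (point) range over the two-element type \<open>2\<close>, and \<open>q\<close>
  (coordinate) over \<open>'m\<close>; the dimension is \<open>CARD('m)\<close>. In the type \<open>2\<close> the numeral \<open>2\<close> equals \<open>0\<close>
  and differs from \<open>1\<close>. Throughout, \<open>z $ p\<close> is the point called \<open>z\<^sup>p\<close>.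
\<close>

definition matA :: "complex ^ 'm ^ 2 \<Rightarrow> complex ^ (2 \<times> 2) ^ (2 \<times> 2)" where
  "matA z = (\<chi> jp jp'. case (jp, jp') of ((j, p), (j', p')) \<Rightarrow>
     of_bool (j = j') * exp (hdot (z $ p) (z $ p')))"

definition matB :: "complex ^ 'm ^ 2 \<Rightarrow> complex ^ (2 \<times> 2 \<times> 'm::finite) ^ (2 \<times> 2)" where
  "matB z = (\<chi> jp jpq'. case (jp, jpq') of ((j, p), (j', p', q')) \<Rightarrow>
     of_bool (j = j') * (z $ p $ q') * exp (hdot (z $ p) (z $ p')))"

definition matC ::
  "complex ^ 'm ^ 2 \<Rightarrow> complex ^ (2 \<times> 2 \<times> 'm::finite) ^ (2 \<times> 2 \<times> 'm::finite)" where
  "matC z = (\<chi> jpq jpq'. case (jpq, jpq') of ((j, p, q), (j', p', q')) \<Rightarrow>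
     of_bool (j = j') * (of_bool (q = q') + cnj (z $ p' $ q) * (z $ p $ q'))
       * exp (hdot (z $ p) (z $ p')))"

definition matLambda ::
  "complex ^ 'm ^ 2 \<Rightarrow> complex ^ (2 \<times> 2 \<times> 'm::finite) ^ (2 \<times> 2 \<times> 'm::finite)" where
  "matLambda z = matC z - ctranspose (matB z) ** matrix_inv (matA z) ** matB z"

definition block :: "complex ^ (2 \<times> 2 \<times> 'm::finite) \<Rightarrow> 2 \<Rightarrow> complex ^ 'm ^ 2"
  where "block a p = (\<chi> j q. a $ (j, p, q))"

definition K22_inf :: "complex ^ 'm::finite \<Rightarrow> complex ^ 'm \<Rightarrow> complex" where
  "K22_inf z1 z2 = (let z = vector [z1, z2] :: complex ^ 'm ^ 2 in
     1 / (of_real (pi ^ 4) * det (matA z)) *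
     (\<integral>a. det (block a 1 ** ctranspose (block a 1)) * det (block a 2 ** ctranspose (block a 2))
        \<partial>complex_gaussian (matLambda z)))"

text \<open>The normalizing factor is the inverse square of the one-point function \<open>m (m - 1) / \<pi>\<^sup>2\<close>.\<close>

definition K22_inf_normalized :: "complex ^ 'm::finite \<Rightarrow> complex ^ 'm \<Rightarrow> complex" where
  "K22_inf_normalized z1 z2 =
     of_real ((pi\<^sup>2 / (real CARD('m) * (real CARD('m) - 1)))\<^sup>2) * K22_inf z1 z2"

definition kappa2 :: "nat \<Rightarrow> real \<Rightarrow> real" where
  "kappa2 n r = (let m = real n; u = r\<^sup>2 in
       ((m\<^sup>2 - m) * exp (2 * u) + 2 * (m - 1) * exp u + 2) / ((exp u - 1)\<^sup>2 * m * (m - 1))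
     - (4 * u * exp u * ((m - 1) * exp u + 1) * (m + 1)) / ((exp u - 1) ^ 3 * (m - 1) * m\<^sup>2)
     + (2 * u\<^sup>2 * exp u * ((m - 1) * exp (2 * u) + 2 * m * exp u + 1))
         / ((exp u - 1) ^ 4 * (m - 1) * m\<^sup>2))"

end

theory Submission
  imports Defs
begin

text \<open>
  The conditional covariance \<open>\<Lambda>\<close> is translation invariant up to the factors \<open>exp (z\<^sup>p \<cdot> z\<^sup>p\<^sup>')\<close>: with
  \<open>w = z\<^sup>1 - z\<^sup>2\<close>, its \<open>(p, p')\<close> block acts on \<open>\<complex>\<^sup>m\<close> as one scalar on the line of \<open>cnj w\<close> and as another
  on the orthogonal complement. Hence \<open>\<Lambda> = T T\<^sup>*\<close> reduces to factoring two Hermitian \<open>2 \<times> 2\<close> matrices,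
  whose positivity comes down to \<open>v \<le> sinh v\<close>, and a Gaussian law with covariance \<open>\<Lambda>\<close> exists.

  The two sections \<open>j = 1, 2\<close> are uncorrelated, so the eighth-order moments factor into products of
  fourth-order ones, which Wick's formula evaluates. Both facts follow from the moments of
  one-dimensional normal variables by polarization, for any law satisfying the definition; uniqueness of
  the law is not required. The resulting index sums are traces of products of the blocks.
\<close>

section \<open>Moments of Gaussian spaces\<close>

text \<open>\<open>complex_gaussian\<close> is defined by a choice, so nothing is known of it until
  some law with covariance \<open>matLambda z\<close> is exhibited; positivity serves this alone. A
  law is given only through its one-dimensional real functionals, possibly degenerate and without a
  joint density, so independence of the two sections is not directly at hand. Its substitute lives
  at the level of moments: for uncorrelated X and Y, polarization of eighth powers gives E X^4 Y^4 =
  E X^4 E Y^4, and fourth powers span all products of four variables. This covers degree four in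
  each section, exactly what the product of the two determinants contains. In the end exp |z^1|^2
  and exp |z^2|^2 enter the expectation only through the square of their product; det A carries the
  same factor, so that only |w|^2 and m remain.\<close>

locale gaussian_space = prob_space M for M :: "'a measure" +
  fixes H :: "('a \<Rightarrow> real) set"
  assumes add_closed: "X \<in> H \<Longrightarrow> Y \<in> H \<Longrightarrow> (\<lambda>x. X x + Y x) \<in> H"
    and scale_closed: "X \<in> H \<Longrightarrow> (\<lambda>x. r * X x) \<in> H"
    and measurable_H: "X \<in> H \<Longrightarrow> X \<in> borel_measurable M"
    and gaussian: "X \<in> H \<Longrightarrow> (AE x in M. X x = 0) \<or>
      (\<exists>\<sigma>>0. distributed M lborel X (\<lambda>t. ennreal (normal_density 0 \<sigma> t)))"
begin

lemma integrable_power: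
  assumes "X \<in> H"
  shows "integrable M (\<lambda>x. X x ^ n)"
  using gaussian[OF assms]
proof
  assume ae: "AE x in M. X x = 0"
  have [measurable]: "X \<in> borel_measurable M" using assms by (rule measurable_H)
  have "integrable M (\<lambda>x. (0::real) ^ n) \<longleftrightarrow> integrable M (\<lambda>x. X x ^ n)"
    using ae by (intro integrable_cong_AE) auto
  then show ?thesis by simp
next
  assume "\<exists>\<sigma>>0. distributed M lborel X (\<lambda>t. ennreal (normal_density 0 \<sigma> t))"
  then obtain \<sigma> where "\<sigma> > 0" and d: "distributed M lborel X (\<lambda>t. ennreal (normal_density 0 \<sigma> t))"
    by blast
  then show ?thesis
    using integrable_normal_moment[OF \<open>\<sigma> > 0\<close>, of 0 n]
    by (subst distributed_integrable[OF d, symmetric]) auto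
qed

text \<open>The constant is the double factorial (2k - 1)!!. Writing the moment in terms of the
  variance, not of \<sigma>, lets the degenerate case share the formula; there k = 0 gives 1 on both
  sides.\<close>

lemma expectation_even_power:
  assumes "X \<in> H"
  shows "expectation (\<lambda>x. X x ^ (2 * k)) =
    fact (2 * k) / (2 ^ k * fact k) * expectation (\<lambda>x. (X x)\<^sup>2) ^ k"
  using gaussian[OF assms]
proof
  assume ae: "AE x in M. X x = 0"
  have [measurable]: "X \<in> borel_measurable M" using assms by (rule measurable_H)
  have "expectation (\<lambda>x. X x ^ n) = expectation (\<lambda>x. 0 ^ n)" for n
    using ae by (intro integral_cong_AE) auto
  then have "expectation (\<lambda>x. X x ^ n) = 0 ^ n" for n by (simp add: prob_space)
  from this[of "2 * k"] this[of 2] show ?thesis by (cases "k = 0") (simp_all add: power_0_left)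
next
  assume "\<exists>\<sigma>>0. distributed M lborel X (\<lambda>t. ennreal (normal_density 0 \<sigma> t))"
  then obtain \<sigma> where s: "\<sigma> > 0" and d: "distributed M lborel X (\<lambda>t. ennreal (normal_density 0 \<sigma> t))"
    by blast
  have m: "expectation (\<lambda>x. X x ^ (2 * j)) = fact (2 * j) / ((2 / \<sigma>\<^sup>2) ^ j * fact j)" for j
    using integral_normal_moment_even[OF s, of 0 j]
    by (subst distributed_integral[OF d, symmetric]) auto
  have "expectation (\<lambda>x. (X x)\<^sup>2) = \<sigma>\<^sup>2" using s m[of 1] by simp
  then show ?thesis using s by (simp add: m[of k] power_divide)
qed

lemma expectation_power4:
  "X \<in> H \<Longrightarrow> expectation (\<lambda>x. X x ^ 4) = 3 * (expectation (\<lambda>x. (X x)\<^sup>2))\<^sup>2"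
  using expectation_even_power[of X 2] by (simp add: fact_numeral)

lemma expectation_power8:
  "X \<in> H \<Longrightarrow> expectation (\<lambda>x. X x ^ 8) = 105 * (expectation (\<lambda>x. (X x)\<^sup>2)) ^ 4"
  using expectation_even_power[of X 4] by (simp add: fact_numeral)

lemma lincomb_closed:
  assumes "X \<in> H" "Y \<in> H"
  shows "(\<lambda>x. a * X x + b * Y x) \<in> H"
  using assms by (intro add_closed scale_closed)

lemma integrable_mult_H:
  assumes "X \<in> H" "Y \<in> H"
  shows "integrable M (\<lambda>x. X x * Y x)"
proof -
  have eq: "(\<lambda>x. X x * Y x) = (\<lambda>x. ((1 * X x + 1 * Y x)\<^sup>2 - (1 * X x + (-1) * Y x)\<^sup>2) / 4)"
    by (auto simp: power2_eq_square algebra_simps)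
  show ?thesis unfolding eq
    by (intro integrable_power lincomb_closed assms integrable_divide Bochner_Integration.integrable_diff)
qed

lemma expectation_square_lincomb:
  assumes "X \<in> H" "Y \<in> H"
  shows "expectation (\<lambda>x. (a * X x + b * Y x)\<^sup>2) = a\<^sup>2 * expectation (\<lambda>x. (X x)\<^sup>2)
    + 2 * a * b * expectation (\<lambda>x. X x * Y x) + b\<^sup>2 * expectation (\<lambda>x. (Y x)\<^sup>2)"
proof -
  have "(\<lambda>x. (a * X x + b * Y x)\<^sup>2) =
    (\<lambda>x. a\<^sup>2 * (X x)\<^sup>2 + 2 * a * b * (X x * Y x) + b\<^sup>2 * (Y x)\<^sup>2)"
    by (auto simp: power2_eq_square algebra_simps)
  then show ?thesis
    using integrable_power[OF assms(1), of 2] integrable_power[OF assms(2), of 2]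
      integrable_mult_H[OF assms] by simp
qed

text \<open>The polarization identity is the one that isolates \<open>X\<^sup>4 Y\<^sup>4\<close> among the eighth powers of
  \<open>X \<plusminus> Y\<close>, \<open>X \<plusminus> 2Y\<close>, \<open>2X \<plusminus> Y\<close>, \<open>X\<close>, \<open>Y\<close>.\<close>

lemma uncorrelated_power4:
  assumes "X \<in> H" "Y \<in> H" and uncor: "expectation (\<lambda>x. X x * Y x) = 0"
  shows "integrable M (\<lambda>x. X x ^ 4 * Y x ^ 4)"
    and "expectation (\<lambda>x. X x ^ 4 * Y x ^ 4) = expectation (\<lambda>x. X x ^ 4) * expectation (\<lambda>x. Y x ^ 4)"
proof -
  define P where "P a b = (\<lambda>x. (a * X x + b * Y x) ^ 8)" for a b
  \<comment> \<open>The pairs of signs remove odd powers. 68 = 4 + 64 cancels x^6 y^2 and x^2 y^6,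
    378 = 2 (1 + 256 - 68) cancels x^8 and y^8, and x^4 y^4 is left with 140 (68 - 16 - 16) =
    5040.\<close>
  have pol: "x ^ 4 * y ^ 4 = (68 * (1 * x + 1 * y) ^ 8 + 68 * (1 * x + (-1) * y) ^ 8
     - (1 * x + 2 * y) ^ 8 - (1 * x + (-2) * y) ^ 8 - (2 * x + 1 * y) ^ 8 - (2 * x + (-1) * y) ^ 8
     + 378 * (1 * x + 0 * y) ^ 8 + 378 * (0 * x + 1 * y) ^ 8) / 5040" for x y :: real
    by (simp add: eval_nat_numeral) (simp add: algebra_simps)
  have eq: "(\<lambda>x. X x ^ 4 * Y x ^ 4) = (\<lambda>x. (68 * P 1 1 x + 68 * P 1 (-1) x
     - P 1 2 x - P 1 (-2) x - P 2 1 x - P 2 (-1) x + 378 * P 1 0 x + 378 * P 0 1 x) / 5040)"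
    unfolding P_def by (intro ext pol)
  have iP [simp]: "integrable M (P a b)" for a b
    unfolding P_def using assms by (intro integrable_power lincomb_closed)
  show "integrable M (\<lambda>x. X x ^ 4 * Y x ^ 4)"
    unfolding eq by simp
  define v w where "v = expectation (\<lambda>x. (X x)\<^sup>2)" and "w = expectation (\<lambda>x. (Y x)\<^sup>2)"
  have eP: "expectation (P a b) = 105 * (a\<^sup>2 * v + b\<^sup>2 * w) ^ 4" for a b
    unfolding P_def v_def w_def
    using assms by (subst expectation_power8) (auto intro: lincomb_closed simp: expectation_square_lincomb)
  \<comment> \<open>The same combination extracts the a^4 b^4 coefficient of 105 (a^2 v + b^2 w)^4,
    which is 630 v^2 w^2; division by the binomial 70 gives 9 v^2 w^2.\<close>
  have "expectation (\<lambda>x. X x ^ 4 * Y x ^ 4) = (3 * v\<^sup>2) * (3 * w\<^sup>2)"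
    unfolding eq by (simp add: eP) (simp add: eval_nat_numeral algebra_simps)
  then show "expectation (\<lambda>x. X x ^ 4 * Y x ^ 4) = expectation (\<lambda>x. X x ^ 4) * expectation (\<lambda>x. Y x ^ 4)"
    by (simp add: assms expectation_power4 v_def w_def)
qed

end

text \<open>Complex span of fourth powers of real variables. As an inductive predicate it allows a
  statement linear in a quartic product to be checked on fourth powers only.\<close>

inductive power4_span :: "('a \<Rightarrow> real) set \<Rightarrow> ('a \<Rightarrow> complex) \<Rightarrow> bool" for A where
  power: "X \<in> A \<Longrightarrow> power4_span A (\<lambda>x. of_real (X x ^ 4))"
| add: "power4_span A f \<Longrightarrow> power4_span A g \<Longrightarrow> power4_span A (\<lambda>x. f x + g x)"
| scale: "power4_span A f \<Longrightarrow> power4_span A (\<lambda>x. c * f x)"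

text \<open>For a real vector space \<open>A\<close> this is A + iA. It is closed under conjugation,
  so coordinates and their conjugates are treated alike.\<close>

definition complexification :: "('a \<Rightarrow> real) set \<Rightarrow> ('a \<Rightarrow> complex) set" where
  "complexification A = {Z. (\<lambda>x. Re (Z x)) \<in> A \<and> (\<lambda>x. Im (Z x)) \<in> A}"

text \<open>Polarization handles four real factors. Then each complex factor is split into real and
  imaginary part, the last one first, while the factors to its left are still real.\<close>

lemma power4_span_prod:
  assumes lin: "\<And>X Y a b. X \<in> A \<Longrightarrow> Y \<in> A \<Longrightarrow> (\<lambda>x. a * X x + b * Y x) \<in> A"
    and "Z1 \<in> complexification A" "Z2 \<in> complexification A"
      "Z3 \<in> complexification A" "Z4 \<in> complexification A"
  shows "power4_span A (\<lambda>x. Z1 x * Z2 x * Z3 x * Z4 x)"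
proof -
  have real: "power4_span A (\<lambda>x. of_real (X1 x) * of_real (X2 x) * of_real (X3 x) * of_real (X4 x))"
    if "X1 \<in> A" "X2 \<in> A" "X3 \<in> A" "X4 \<in> A" for X1 X2 X3 X4
  proof -
    define P where "P a b c = (\<lambda>x. complex_of_real
      ((1 * (1 * X1 x + a * X2 x) + 1 * (b * X3 x + c * X4 x)) ^ 4))" for a b c
    have P: "power4_span A (P a b c)" for a b c
      unfolding P_def using that by (intro power4_span.power lin)
    \<comment> \<open>Each fourth power (x + ay + bz + cw)^4 with signs a, b, c is weighted by abc.
      Parity removes every monomial except xyzw, which collects 24 from each of the 8 terms, hence
      192.\<close>
    have pol: "x * y * z * w = ((x + y + (z + w)) ^ 4 - (x + y + (z - w)) ^ 4
      - (x + y + (- z + w)) ^ 4 + (x + y + (- z - w)) ^ 4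
      - (x - y + (z + w)) ^ 4 + (x - y + (z - w)) ^ 4
      + (x - y + (- z + w)) ^ 4 - (x - y + (- z - w)) ^ 4) / 192" for x y z w :: real
      by (simp add: eval_nat_numeral) (simp add: algebra_simps)
    have "(\<lambda>x. of_real (X1 x) * of_real (X2 x) * of_real (X3 x) * of_real (X4 x)) =
      (\<lambda>x. (1/192) * P 1 1 1 x + (- 1/192) * P 1 1 (-1) x + (- 1/192) * P 1 (-1) 1 x
       + (1/192) * P 1 (-1) (-1) x + (- 1/192) * P (-1) 1 1 x + (1/192) * P (-1) 1 (-1) x
       + (1/192) * P (-1) (-1) 1 x + (- 1/192) * P (-1) (-1) (-1) x)"
      unfolding P_def by (intro ext, unfold of_real_mult[symmetric], subst pol) simp
    then show ?thesis
      by (simp only:) (intro power4_span.add power4_span.scale P)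
  qed
  have split: "power4_span A (\<lambda>x. F x * Z x * G x)"
    if "power4_span A (\<lambda>x. F x * of_real (Re (Z x)) * G x)"
      "power4_span A (\<lambda>x. F x * of_real (Im (Z x)) * G x)" for F G Z
  proof -
    have "(\<lambda>x. F x * Z x * G x) =
       (\<lambda>x. F x * of_real (Re (Z x)) * G x + \<i> * (F x * of_real (Im (Z x)) * G x))"
      by (intro ext, subst complex_eq) (simp add: algebra_simps)
    then show ?thesis
      by (simp only:) (intro power4_span.add power4_span.scale that)
  qed
  have R: "(\<lambda>x. Re (Z x)) \<in> A" "(\<lambda>x. Im (Z x)) \<in> A" if "Z \<in> complexification A" for Z
    using that by (auto simp: complexification_def)
  note r1 = R[OF assms(2)] and r2 = R[OF assms(3)] and r3 = R[OF assms(4)] and r4 = R[OF assms(5)]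
  have s4: "power4_span A (\<lambda>x. of_real (X1 x) * of_real (X2 x) * of_real (X3 x) * Z4 x)"
    if "X1 \<in> A" "X2 \<in> A" "X3 \<in> A" for X1 X2 X3
    using split[where Z=Z4 and G="\<lambda>_. 1" and F="\<lambda>x. of_real (X1 x) * of_real (X2 x) * of_real (X3 x)"]
      real[OF that] r4 by simp
  have s3: "power4_span A (\<lambda>x. of_real (X1 x) * of_real (X2 x) * Z3 x * Z4 x)"
    if "X1 \<in> A" "X2 \<in> A" for X1 X2
    by (rule split[where Z=Z3 and G=Z4 and F="\<lambda>x. of_real (X1 x) * of_real (X2 x)"])
      (intro s4 that r3)+
  have s2: "power4_span A (\<lambda>x. of_real (X1 x) * Z2 x * Z3 x * Z4 x)"
    if "X1 \<in> A" for X1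
    using split[where Z=Z2 and G="\<lambda>x. Z3 x * Z4 x" and F="\<lambda>x. of_real (X1 x)"]
      s3[OF that r2(1)] s3[OF that r2(2)] by (simp add: mult.assoc)
  show ?thesis
    using split[where Z=Z1 and G="\<lambda>x. Z2 x * Z3 x * Z4 x" and F="\<lambda>x. 1"]
      s2[OF r1(1)] s2[OF r1(2)] by (simp add: mult.assoc)
qed

context gaussian_space begin

lemma integrable_power4_span:
  assumes "power4_span A f" "A \<subseteq> H"
  shows "integrable M f"
  using assms
  by induction (auto simp del: of_real_power intro!: integrable_of_real integrable_power)

text \<open>Both sides are bilinear in f and g, so a nested induction reduces the claim to two
  fourth powers, where \<open>uncorrelated_power4\<close> applies.\<close>

lemma expectation_mult_power4_span:
  fixes f g :: "'a \<Rightarrow> complex"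
  assumes "power4_span A f" "power4_span B g" "A \<subseteq> H" "B \<subseteq> H"
    and uncor: "\<And>X Y. X \<in> A \<Longrightarrow> Y \<in> B \<Longrightarrow> expectation (\<lambda>x. X x * Y x) = 0"
  shows "integrable M (\<lambda>x. f x * g x) \<and>
    (\<integral>x. f x * g x \<partial>M) = (\<integral>x. f x \<partial>M) * (\<integral>x. g x \<partial>M)"
  using assms(1)
proof induction
  case (power X)
  then have X: "X \<in> H" using assms by auto
  show ?case
    using assms(2)
  proof induction
    case (power Y)
    then have Y: "Y \<in> H" using assms by auto
    show ?case
      using uncorrelated_power4[OF X Y uncor[OF \<open>X \<in> A\<close> \<open>Y \<in> B\<close>]]
      by (simp flip: of_real_mult of_real_power)
  next
    case (add g h)
    then show ?case
      using integrable_power4_span[of B g] integrable_power4_span[of B h] assms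
      by (simp add: distrib_left)
  next
    case (scale g c)
    then show ?case by (simp add: mult.left_commute)
  qed
next
  case (add f h)
  then show ?case
    using integrable_power4_span[of A f] integrable_power4_span[of A h] assms
    by (simp add: distrib_right)
next
  case (scale f c)
  then show ?case by (simp add: mult.assoc)
qed

text \<open>A fourth moment is 3 V^2 with V the variance, a quadratic form in the coefficients of
  the combination. Polarizing its square produces the sum over the three pairings.\<close>

lemma expectation_prod4_real:
  assumes "X1 \<in> H" "X2 \<in> H" "X3 \<in> H" "X4 \<in> H"
  shows "expectation (\<lambda>x. X1 x * X2 x * X3 x * X4 x) =
    expectation (\<lambda>x. X1 x * X2 x) * expectation (\<lambda>x. X3 x * X4 x) +
    expectation (\<lambda>x. X1 x * X3 x) * expectation (\<lambda>x. X2 x * X4 x) +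
    expectation (\<lambda>x. X1 x * X4 x) * expectation (\<lambda>x. X2 x * X3 x)"
proof -
  define P where "P a b c = (\<lambda>x. (1 * (1 * X1 x + a * X2 x) + 1 * (b * X3 x + c * X4 x)) ^ 4)" for a b c
  have iP [simp]: "integrable M (P a b c)" for a b c
    unfolding P_def using assms by (intro integrable_power lincomb_closed)
  define V where "V X Y = expectation (\<lambda>x. X x * Y x)" for X Y :: "'a \<Rightarrow> real"
  have lin: "V (\<lambda>x. a * X x + b * Y x) (\<lambda>x. c * Z x + d * W x) =
     a * c * V X Z + a * d * V X W + b * c * V Y Z + b * d * V Y W"
    if "X \<in> H" "Y \<in> H" "Z \<in> H" "W \<in> H" for a b c d X Y Z W
  proof -
    have "(\<lambda>x. (a * X x + b * Y x) * (c * Z x + d * W x)) =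
      (\<lambda>x. a * c * (X x * Z x) + a * d * (X x * W x) + b * c * (Y x * Z x) + b * d * (Y x * W x))"
      by (auto simp: algebra_simps)
    then show ?thesis
      unfolding V_def using that by (simp add: integrable_mult_H)
  qed
  have sq: "expectation (\<lambda>x. (X x)\<^sup>2) = V X X" for X
    by (simp add: V_def power2_eq_square)
  have comm: "V X Y = V Y X" for X Y
    by (simp add: V_def mult.commute)
  have eP: "expectation (P a b c) = 3 * (V X1 X1 + a\<^sup>2 * V X2 X2 + b\<^sup>2 * V X3 X3 + c\<^sup>2 * V X4 X4
    + 2 * a * V X1 X2 + 2 * b * V X1 X3 + 2 * c * V X1 X4 + 2 * a * b * V X2 X3 + 2 * a * c * V X2 X4
    + 2 * b * c * V X3 X4)\<^sup>2" for a b c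
  proof -
    define Y Z where "Y = (\<lambda>x. 1 * X1 x + a * X2 x)" and "Z = (\<lambda>x. b * X3 x + c * X4 x)"
    have "Y \<in> H" "Z \<in> H"
      unfolding Y_def Z_def
      by (rule lincomb_closed[OF assms(1,2)], rule lincomb_closed[OF assms(3,4)])
    moreover have "P a b c = (\<lambda>x. (1 * Y x + 1 * Z x) ^ 4)"
      by (simp add: P_def Y_def Z_def)
    ultimately have "expectation (P a b c) = 3 * (V Y Y + 2 * V Y Z + V Z Z)\<^sup>2"
      by (simp only: expectation_power4 lincomb_closed expectation_square_lincomb flip: sq)
        (simp add: V_def)
    moreover have "V Y Y = V X1 X1 + 2 * a * V X1 X2 + a\<^sup>2 * V X2 X2"
      "V Y Z = b * V X1 X3 + c * V X1 X4 + a * b * V X2 X3 + a * c * V X2 X4"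
      "V Z Z = b\<^sup>2 * V X3 X3 + 2 * b * c * V X3 X4 + c\<^sup>2 * V X4 X4"
      unfolding Y_def Z_def using assms
      by (simp_all only: lin) (simp_all add: comm[of X2 X1] comm[of X4 X3] power2_eq_square algebra_simps)
    ultimately show ?thesis by (simp add: algebra_simps)
  qed
  have pol: "x * y * z * w = ((x + y + (z + w)) ^ 4 - (x + y + (z - w)) ^ 4
      - (x + y + (- z + w)) ^ 4 + (x + y + (- z - w)) ^ 4
      - (x - y + (z + w)) ^ 4 + (x - y + (z - w)) ^ 4
      + (x - y + (- z + w)) ^ 4 - (x - y + (- z - w)) ^ 4) / 192" for x y z w :: real
    by (simp add: eval_nat_numeral) (simp add: algebra_simps)
  have eq: "(\<lambda>x. X1 x * X2 x * X3 x * X4 x) =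
      (\<lambda>x. (P 1 1 1 x - P 1 1 (-1) x - P 1 (-1) 1 x + P 1 (-1) (-1) x - P (-1) 1 1 x + P (-1) 1 (-1) x
       + P (-1) (-1) 1 x - P (-1) (-1) (-1) x) / 192)"
    unfolding P_def by (intro ext, subst pol) simp
  have "expectation (\<lambda>x. X1 x * X2 x * X3 x * X4 x) =
      V X1 X2 * V X3 X4 + V X1 X3 * V X2 X4 + V X1 X4 * V X2 X3"
    unfolding eq by (simp add: eP) (simp add: power2_eq_square algebra_simps)
  then show ?thesis
    by (simp only: V_def)
qed

section \<open>Wick's formula for complex variables\<close>

lemma integrable_mult_complexification:
  assumes "Z \<in> complexification H" "W \<in> complexification H"
  shows "integrable M (\<lambda>x. Z x * W x)"
proof -
  have "integrable M (\<lambda>x. complex_of_real (X x * Y x))" if "X \<in> H" "Y \<in> H" for X Y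
    using integrable_mult_H[OF that] by (rule integrable_of_real)
  then have i: "integrable M (\<lambda>x. complex_of_real (X x) * complex_of_real (Y x))" if "X \<in> H" "Y \<in> H" for X Y
    using that by simp
  have eq: "(\<lambda>x. Z x * W x) = (\<lambda>x. of_real (Re (Z x)) * of_real (Re (W x))
     + \<i> * (of_real (Re (Z x)) * of_real (Im (W x))) + \<i> * (of_real (Im (Z x)) * of_real (Re (W x)))
     - of_real (Im (Z x)) * of_real (Im (W x)))"
    by (auto simp: complex_eq_iff)
  show ?thesis
    unfolding eq using assms
    by (intro Bochner_Integration.integrable_diff Bochner_Integration.integrable_add integrable_mult_right i)
      (auto simp: complexification_def)
qed

lemma integrable_prod4:
  assumes "Z1 \<in> complexification H" "Z2 \<in> complexification H"
    "Z3 \<in> complexification H" "Z4 \<in> complexification H"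
  shows "integrable M (\<lambda>x. Z1 x * Z2 x * Z3 x * Z4 x)"
  by (rule integrable_power4_span[where A=H], rule power4_span_prod) (auto intro: lincomb_closed assms)

text \<open>Both sides are linear in each factor, and the claim \<open>Q\<close> is invariant under
  cyclic shifts. Hence it suffices to pass from real to complex in the first slot
  (\<open>slot\<close>); four shifts bring every factor there once.\<close>

theorem wick4:
  fixes Z1 Z2 Z3 Z4 :: "'a \<Rightarrow> complex"
  assumes "Z1 \<in> complexification H" "Z2 \<in> complexification H"
    "Z3 \<in> complexification H" "Z4 \<in> complexification H"
  shows "(\<integral>x. Z1 x * Z2 x * Z3 x * Z4 x \<partial>M) =
    (\<integral>x. Z1 x * Z2 x \<partial>M) * (\<integral>x. Z3 x * Z4 x \<partial>M) +
    (\<integral>x. Z1 x * Z3 x \<partial>M) * (\<integral>x. Z2 x * Z4 x \<partial>M) +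
    (\<integral>x. Z1 x * Z4 x \<partial>M) * (\<integral>x. Z2 x * Z3 x \<partial>M)"
proof -
  define W where "W f g = (\<integral>x. f x * g x \<partial>M)" for f g :: "'a \<Rightarrow> complex"
  define Q where "Q a b c d \<longleftrightarrow> (\<integral>x. a x * b x * c x * d x \<partial>M) =
    W a b * W c d + W a c * W b d + W a d * W b c" for a b c d
  define R I :: "('a \<Rightarrow> complex) \<Rightarrow> 'a \<Rightarrow> complex"
    where "R Z = (\<lambda>x. of_real (Re (Z x)))" and "I Z = (\<lambda>x. of_real (Im (Z x)))" for Z
  let ?C = "complexification H"
  have W_comm: "W f g = W g f" for f g by (simp add: W_def mult.commute)
  have rot: "Q a b c d \<longleftrightarrow> Q b c d a" for a b c d
  proof -
    have "(\<lambda>x. b x * c x * d x * a x) = (\<lambda>x. a x * b x * c x * d x)"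
      by (simp add: fun_eq_iff)
    then show ?thesis
      by (simp add: Q_def W_comm[of _ a] algebra_simps)
  qed
  have zero: "(\<lambda>x. 0) \<in> H" if "X \<in> H" for X
    using scale_closed[OF that, of 0] by simp
  have real_in: "(\<lambda>x. of_real (X x)) \<in> ?C" if "X \<in> H" for X
    using that zero[OF that] by (simp add: complexification_def)
  have RI: "R Z \<in> ?C" "I Z \<in> ?C" if "Z \<in> ?C" for Z
    using that by (auto simp: R_def I_def complexification_def intro: zero)
  have slot: "Q a b c d"
    if *: "Q (R a) b c d" "Q (I a) b c d" and in_C: "a \<in> ?C" "b \<in> ?C" "c \<in> ?C" "d \<in> ?C" for a b c d
  proof -
    have split: "a x = R a x + \<i> * I a x" for x
      by (simp add: R_def I_def complex_eq[symmetric])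
    have W: "W a g = W (R a) g + \<i> * W (I a) g" if "g \<in> ?C" for g
    proof -
      have "(\<lambda>x. a x * g x) = (\<lambda>x. R a x * g x + \<i> * (I a x * g x))"
        by (subst split) (simp add: algebra_simps)
      then show ?thesis
        unfolding W_def using in_C that by (simp add: RI integrable_mult_complexification)
    qed
    have "(\<lambda>x. a x * b x * c x * d x) =
        (\<lambda>x. R a x * b x * c x * d x + \<i> * (I a x * b x * c x * d x))"
      by (subst split) (simp add: algebra_simps)
    then have "(\<integral>x. a x * b x * c x * d x \<partial>M) = (\<integral>x. R a x * b x * c x * d x \<partial>M)
        + \<i> * (\<integral>x. I a x * b x * c x * d x \<partial>M)"
      using in_C by (simp add: RI integrable_prod4)
    then show ?thesis
      using * in_C by (simp add: Q_def W algebra_simps)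
  qed
  have real: "Q (\<lambda>x. of_real (X1 x)) (\<lambda>x. of_real (X2 x)) (\<lambda>x. of_real (X3 x)) (\<lambda>x. of_real (X4 x))"
    if "X1 \<in> H" "X2 \<in> H" "X3 \<in> H" "X4 \<in> H" for X1 X2 X3 X4
    using expectation_prod4_real[OF that] by (simp add: Q_def W_def flip: of_real_mult of_real_add)
  have Q0: "Q a b c d"
    if "a \<in> {R Z1, I Z1}" "b \<in> {R Z2, I Z2}" "c \<in> {R Z3, I Z3}" "d \<in> {R Z4, I Z4}" for a b c d
    using that assms by (auto simp: R_def I_def complexification_def intro!: real)
  have Q1: "Q Z1 b c d" if "b \<in> {R Z2, I Z2}" "c \<in> {R Z3, I Z3}" "d \<in> {R Z4, I Z4}" for b c d
    by (rule slot) (use that assms in \<open>auto intro: Q0 RI\<close>)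
  have Q2: "Q Z2 c d Z1" if "c \<in> {R Z3, I Z3}" "d \<in> {R Z4, I Z4}" for c d
    by (rule slot) (use that assms in \<open>auto intro: Q1[unfolded rot[of Z1]] RI\<close>)
  have Q3: "Q Z3 d Z1 Z2" if "d \<in> {R Z4, I Z4}" for d
    by (rule slot) (use that assms in \<open>auto intro: Q2[unfolded rot[of Z2]] RI\<close>)
  have "Q Z4 Z1 Z2 Z3"
    by (rule slot) (use assms in \<open>auto intro: Q3[unfolded rot[of Z3]] RI\<close>)
  then show ?thesis
    unfolding rot[of Z4] by (simp add: Q_def W_def)
qed

text \<open>The moment form of independence: it asks only that real variables of \<open>A\<close>
  and \<open>B\<close> be uncorrelated, inside a common Gaussian space.\<close>

lemma expectation_prod8_uncorrelated:
  fixes Z1 Z2 Z3 Z4 W1 W2 W3 W4 :: "'a \<Rightarrow> complex"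
  assumes "A \<subseteq> H" "B \<subseteq> H"
    and uncor: "\<And>X Y. X \<in> A \<Longrightarrow> Y \<in> B \<Longrightarrow> expectation (\<lambda>x. X x * Y x) = 0"
    and "\<And>X Y a b. X \<in> A \<Longrightarrow> Y \<in> A \<Longrightarrow> (\<lambda>x. a * X x + b * Y x) \<in> A"
    and "\<And>X Y a b. X \<in> B \<Longrightarrow> Y \<in> B \<Longrightarrow> (\<lambda>x. a * X x + b * Y x) \<in> B"
    and Z: "Z1 \<in> complexification A" "Z2 \<in> complexification A"
      "Z3 \<in> complexification A" "Z4 \<in> complexification A"
    and W: "W1 \<in> complexification B" "W2 \<in> complexification B"
      "W3 \<in> complexification B" "W4 \<in> complexification B"
  shows "integrable M (\<lambda>x. (Z1 x * Z2 x * Z3 x * Z4 x) * (W1 x * W2 x * W3 x * W4 x))"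
    and "(\<integral>x. (Z1 x * Z2 x * Z3 x * Z4 x) * (W1 x * W2 x * W3 x * W4 x) \<partial>M) =
      (\<integral>x. Z1 x * Z2 x * Z3 x * Z4 x \<partial>M) * (\<integral>x. W1 x * W2 x * W3 x * W4 x \<partial>M)"
  by (simp_all add: expectation_mult_power4_span[OF power4_span_prod[OF assms(4) Z]
      power4_span_prod[OF assms(5) W] assms(1,2) uncor])

end

section \<open>Complex Gaussian laws\<close>

definition re_functional :: "complex ^ 'i \<Rightarrow> complex ^ 'i \<Rightarrow> real" where
  "re_functional c x = Re (\<Sum>i\<in>UNIV. c $ i * x $ i)"

lemma re_functional_add: "re_functional (c + d) x = re_functional c x + re_functional d x"
  by (simp add: re_functional_def distrib_right sum.distrib)

lemma re_functional_scaleR: "re_functional (r *\<^sub>R c) x = r * re_functional c x"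
  by (simp add: re_functional_def scaleR_sum_right[symmetric] del: Re_sum)

lemma re_functional_axis: "re_functional (axis i a) x = Re (a * x $ i)"
proof -
  have "(\<Sum>k\<in>UNIV. axis i a $ k * x $ k) = (\<Sum>k\<in>UNIV. if k = i then a * x $ i else 0)"
    by (intro sum.cong) (auto simp: axis_def)
  then show ?thesis by (simp add: re_functional_def del: Re_sum)
qed

text \<open>The real Gaussian space generated by the coordinates in \<open>S\<close>. Taking for
  \<open>S\<close> the coordinates of one section separates the two sections.\<close>

definition coordinate_functionals :: "'i set \<Rightarrow> (complex ^ 'i \<Rightarrow> real) set" where
  "coordinate_functionals S = re_functional ` {c. \<forall>i. i \<notin> S \<longrightarrow> c $ i = 0}"

lemma coordinate_functionals_lincomb:
  assumes "X \<in> coordinate_functionals S" "Y \<in> coordinate_functionals S"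
  shows "(\<lambda>x. a * X x + b * Y x) \<in> coordinate_functionals S"
proof -
  obtain c d where "X = re_functional c" "Y = re_functional d"
    "\<forall>i. i \<notin> S \<longrightarrow> c $ i = 0" "\<forall>i. i \<notin> S \<longrightarrow> d $ i = 0"
    using assms by (auto simp: coordinate_functionals_def)
  then show ?thesis
    unfolding coordinate_functionals_def
    by (intro image_eqI[of _ _ "a *\<^sub>R c + b *\<^sub>R d"]) (auto simp: re_functional_add re_functional_scaleR)
qed

lemma coordinate_functionals_mono: "S \<subseteq> T \<Longrightarrow> coordinate_functionals S \<subseteq> coordinate_functionals T"
  by (auto simp: coordinate_functionals_def)

lemma coordinate_in_complexification:
  assumes "i \<in> S"
  shows "(\<lambda>x. x $ i) \<in> complexification (coordinate_functionals S)"
    and "(\<lambda>x. cnj (x $ i)) \<in> complexification (coordinate_functionals S)"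
proof -
  have *: "re_functional (axis i a) \<in> coordinate_functionals S" for a
    using assms by (auto simp: coordinate_functionals_def axis_def)
  have "re_functional (axis i 1) = (\<lambda>x. Re (x $ i))"
    "re_functional (axis i (-\<i>)) = (\<lambda>x. Im (x $ i))"
    "re_functional (axis i \<i>) = (\<lambda>x. - Im (x $ i))"
    by (auto simp: re_functional_axis)
  with *[of 1] *[of "-\<i>"] *[of \<i>]
  show "(\<lambda>x. x $ i) \<in> complexification (coordinate_functionals S)"
    and "(\<lambda>x. cnj (x $ i)) \<in> complexification (coordinate_functionals S)"
    by (simp_all add: complexification_def)
qed

lemma gaussian_space_coordinate_functionals:
  assumes "centered_gaussian_law \<mu>"
  shows "gaussian_space \<mu> (coordinate_functionals UNIV)"
proof -
  interpret prob_space \<mu> using assms by (simp add: centered_gaussian_law_def)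
  have sets: "sets \<mu> = sets borel" using assms by (simp add: centered_gaussian_law_def)
  show ?thesis
  proof
    fix X Y :: "complex ^ 'a \<Rightarrow> real" and r :: real
    assume X: "X \<in> coordinate_functionals UNIV"
    show "(\<lambda>x. r * X x) \<in> coordinate_functionals UNIV"
      using coordinate_functionals_lincomb[OF X X, of r 0] by simp
    show "(\<lambda>x. X x + Y x) \<in> coordinate_functionals UNIV" if Y: "Y \<in> coordinate_functionals UNIV"
      using coordinate_functionals_lincomb[OF X Y, of 1 1] by simp
    obtain c where c: "X = re_functional c"
      using X by (auto simp: coordinate_functionals_def)
    have "re_functional c \<in> borel_measurable borel"
      unfolding re_functional_def by (intro borel_measurable_continuous_onI continuous_intros)
    then show "X \<in> borel_measurable \<mu>"
      unfolding c using sets by (simp cong: measurable_cong_sets)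
    have "X = (\<lambda>x. Re (\<Sum>i\<in>UNIV. c $ i * x $ i))"
      unfolding c by (simp add: re_functional_def fun_eq_iff)
    then show "(AE x in \<mu>. X x = 0) \<or>
      (\<exists>\<sigma>>0. distributed \<mu> lborel X (\<lambda>t. ennreal (normal_density 0 \<sigma> t)))"
      using assms by (simp only: centered_gaussian_law_def)
  qed
qed

text \<open>Of the three pairings, the one joining \<open>i\<close> with \<open>s\<close> vanishes
  because E x_i x_s = 0.\<close>

lemma complex_gaussian_wick4:
  assumes "complex_gaussian_law \<Lambda> \<mu>"
  shows "(\<integral>x. x $ i * cnj (x $ k) * x $ s * cnj (x $ l) \<partial>\<mu>) = \<Lambda> $ i $ k * \<Lambda> $ s $ l + \<Lambda> $ i $ l * \<Lambda> $ s $ k"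
proof -
  interpret gaussian_space \<mu> "coordinate_functionals UNIV"
    using assms by (intro gaussian_space_coordinate_functionals) (simp add: complex_gaussian_law_def)
  show ?thesis
    using assms by (subst wick4)
      (auto simp: complex_gaussian_law_def coordinate_in_complexification mult.commute[of "cnj _" "_ $ _"])
qed

text \<open>Since Re a Re b = Re (ab + a cnj b) / 2, real correlations come from two kinds of
  complex ones. The products ab have mean zero for every complex Gaussian law, the products a cnj b
  because \<Lambda> vanishes between \<open>S\<close> and \<open>T\<close>.\<close>

lemma complex_gaussian_uncorrelated:
  assumes law: "complex_gaussian_law \<Lambda> \<mu>"
    and zero: "\<And>i k. i \<in> S \<Longrightarrow> k \<in> T \<Longrightarrow> \<Lambda> $ i $ k = 0"
    and X: "X \<in> coordinate_functionals S" and Y: "Y \<in> coordinate_functionals T"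
  shows "(\<integral>x. X x * Y x \<partial>\<mu>) = 0"
proof -
  interpret gaussian_space \<mu> "coordinate_functionals UNIV"
    using law by (intro gaussian_space_coordinate_functionals) (simp add: complex_gaussian_law_def)
  obtain c d where c: "X = re_functional c" "\<And>i. i \<notin> S \<Longrightarrow> c $ i = 0"
    and d: "Y = re_functional d" "\<And>i. i \<notin> T \<Longrightarrow> d $ i = 0"
    using X Y by (auto simp: coordinate_functionals_def)
  have int: "integrable \<mu> (\<lambda>x. x $ i * x $ k)" "integrable \<mu> (\<lambda>x. x $ i * cnj (x $ k))" for i k
    by (intro integrable_mult_complexification coordinate_in_complexification UNIV_I)+
  define F where "F = (\<lambda>x. \<Sum>i\<in>UNIV. \<Sum>k\<in>UNIV. (c $ i * d $ k) * (x $ i * x $ k)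
     + (c $ i * cnj (d $ k)) * (x $ i * cnj (x $ k)))"
  have "integrable \<mu> F"
    unfolding F_def by (intro Bochner_Integration.integrable_sum Bochner_Integration.integrable_add
        integrable_mult_right int)
  have "X x * Y x = Re (F x) / 2" for x
  proof -
    have "Re a * Re b = Re (a * b + a * cnj b) / 2" for a b :: complex
      by (simp add: algebra_simps)
    then have "X x * Y x = Re ((\<Sum>i\<in>UNIV. c $ i * x $ i) * (\<Sum>i\<in>UNIV. d $ i * x $ i)
        + (\<Sum>i\<in>UNIV. c $ i * x $ i) * cnj (\<Sum>i\<in>UNIV. d $ i * x $ i)) / 2"
      unfolding c(1) d(1) re_functional_def by blast
    also have "\<dots> = Re (F x) / 2"
      unfolding F_def sum_product sum.distrib cnj_sum by (simp add: mult_ac del: Re_sum)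
    finally show ?thesis .
  qed
  then have eq: "(\<lambda>x. X x * Y x) = (\<lambda>x. Re (F x) / 2)"
    by (intro ext)
  have "(\<integral>x. X x * Y x \<partial>\<mu>) = Re (\<integral>x. F x \<partial>\<mu>) / 2"
    unfolding eq using \<open>integrable \<mu> F\<close> by simp
  moreover have "(\<integral>x. F x \<partial>\<mu>) = (\<Sum>i\<in>UNIV. \<Sum>k\<in>UNIV. c $ i * cnj (d $ k) * \<Lambda> $ i $ k)"
    unfolding F_def using law int
    by (simp add: complex_gaussian_law_def)
  moreover have "c $ i * cnj (d $ k) * \<Lambda> $ i $ k = 0" for i k
    using c(2)[of i] d(2)[of k] zero[of i k] by (cases "i \<in> S"; cases "k \<in> T") auto
  ultimately show ?thesis by simp
qed

lemma complex_gaussian_prod8_uncorrelated: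
  assumes law: "complex_gaussian_law \<Lambda> \<mu>"
    and zero: "\<And>i k. i \<in> S \<Longrightarrow> k \<in> T \<Longrightarrow> \<Lambda> $ i $ k = 0"
    and S: "i \<in> S" "k \<in> S" "s \<in> S" "l \<in> S" and T: "i' \<in> T" "k' \<in> T" "s' \<in> T" "l' \<in> T"
  defines "f \<equiv> \<lambda>x. (x $ i * cnj (x $ k) * x $ s * cnj (x $ l)) *
      (x $ i' * cnj (x $ k') * x $ s' * cnj (x $ l'))"
  shows "integrable \<mu> f"
    and "(\<integral>x. f x \<partial>\<mu>) = (\<Lambda> $ i $ k * \<Lambda> $ s $ l + \<Lambda> $ i $ l * \<Lambda> $ s $ k) *
       (\<Lambda> $ i' $ k' * \<Lambda> $ s' $ l' + \<Lambda> $ i' $ l' * \<Lambda> $ s' $ k')"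
proof -
  interpret gaussian_space \<mu> "coordinate_functionals UNIV"
    using law by (intro gaussian_space_coordinate_functionals) (simp add: complex_gaussian_law_def)
  note * = expectation_prod8_uncorrelated[OF coordinate_functionals_mono coordinate_functionals_mono
      complex_gaussian_uncorrelated[OF law zero] coordinate_functionals_lincomb
      coordinate_functionals_lincomb coordinate_in_complexification(1)[OF S(1)]
      coordinate_in_complexification(2)[OF S(2)] coordinate_in_complexification(1)[OF S(3)]
      coordinate_in_complexification(2)[OF S(4)] coordinate_in_complexification(1)[OF T(1)]
      coordinate_in_complexification(2)[OF T(2)] coordinate_in_complexification(1)[OF T(3)]
      coordinate_in_complexification(2)[OF T(4)]]
  show "integrable \<mu> f" unfolding f_def by (rule *) auto
  show "(\<integral>x. f x \<partial>\<mu>) = (\<Lambda> $ i $ k * \<Lambda> $ s $ l + \<Lambda> $ i $ l * \<Lambda> $ s $ k) *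
       (\<Lambda> $ i' $ k' * \<Lambda> $ s' $ l' + \<Lambda> $ i' $ l' * \<Lambda> $ s' $ k')"
    unfolding f_def by (subst *) (auto simp: complex_gaussian_wick4[OF law])
qed

section \<open>Existence of complex Gaussian laws\<close>

definition iid_normal :: "('j \<Rightarrow> real) measure" where
  "iid_normal = (\<Pi>\<^sub>M j\<in>UNIV. density lborel (\<lambda>t. ennreal (std_normal_density t)))"

lemma sets_iid_normal [measurable_cong]: "sets iid_normal = sets (\<Pi>\<^sub>M j\<in>UNIV. borel)"
  unfolding iid_normal_def by (intro sets_PiM_cong) auto

lemma prob_space_iid_normal: "prob_space iid_normal"
  unfolding iid_normal_def by (intro prob_space_PiM prob_space_normal_density) simp

lemma distributed_iid_normal_component:
  "distributed iid_normal lborel (\<lambda>\<omega>. \<omega> j) (\<lambda>t. ennreal (std_normal_density t))"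
proof -
  have "distr iid_normal lborel (\<lambda>\<omega>. \<omega> j) =
      distr iid_normal (density lborel (\<lambda>t. ennreal (std_normal_density t))) (\<lambda>\<omega>. \<omega> j)"
    by (intro distr_cong) auto
  also have "\<dots> = density lborel (\<lambda>t. ennreal (std_normal_density t))"
    unfolding iid_normal_def by (intro distr_PiM_component prob_space_normal_density) auto
  finally show ?thesis
    unfolding distributed_def by simp
qed

lemma indep_vars_iid_normal: 
  "prob_space.indep_vars iid_normal (\<lambda>_. borel) (\<lambda>j \<omega>. \<omega> j) (UNIV :: 'j set)"
proof -
  interpret prob_space "iid_normal :: ('j \<Rightarrow> real) measure" by (rule prob_space_iid_normal)
  have d: "distr (iid_normal :: ('j \<Rightarrow> real) measure) borel (\<lambda>\<omega>. \<omega> j) =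
      density lborel (\<lambda>t. ennreal (std_normal_density t))" for j
  proof -
    have "distr (iid_normal :: ('j \<Rightarrow> real) measure) borel (\<lambda>\<omega>. \<omega> j) = distr iid_normal lborel (\<lambda>\<omega>. \<omega> j)"
      by (intro distr_cong) auto
    then show ?thesis
      using distributed_iid_normal_component[of j] by (simp add: distributed_def)
  qed
  show ?thesis
  proof (subst indep_vars_iff_distr_eq_PiM)
    \<comment> \<open>The joint map of all coordinates is the identity, so the joint law is the
      product measure itself.\<close>
    have "distr iid_normal (\<Pi>\<^sub>M i\<in>UNIV. borel) (\<lambda>x. \<lambda>i\<in>UNIV. x i) =
       distr (iid_normal :: ('j \<Rightarrow> real) measure) iid_normal (\<lambda>x. x)"
      by (intro distr_cong) (auto simp: sets_iid_normal)
    then show "distr iid_normal (\<Pi>\<^sub>M i\<in>UNIV. borel) (\<lambda>x. \<lambda>i\<in>UNIV. x i) =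
      (\<Pi>\<^sub>M i\<in>(UNIV :: 'j set). distr iid_normal borel (\<lambda>\<omega>. \<omega> i))"
      by (simp add: distr_id d) (simp add: iid_normal_def)
  qed auto
qed

lemma distributed_linear_iid_normal:
  fixes a :: "'j::finite \<Rightarrow> real"
  assumes "a j \<noteq> 0"
  shows "distributed iid_normal lborel (\<lambda>\<omega>. \<Sum>j\<in>UNIV. a j * \<omega> j)
    (\<lambda>t. ennreal (normal_density 0 (sqrt (\<Sum>j\<in>UNIV. (a j)\<^sup>2)) t))"
proof -
  interpret prob_space "iid_normal :: ('j \<Rightarrow> real) measure" by (rule prob_space_iid_normal)
  \<comment> \<open>A normal density requires a positive standard deviation, so terms with
    coefficient zero are dropped before independent normals are added.\<close>
  define I where "I = {j. a j \<noteq> 0}"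
  have "distributed iid_normal lborel (\<lambda>\<omega>. \<Sum>j\<in>I. a j * \<omega> j)
    (normal_density (\<Sum>j\<in>I. 0) (sqrt (\<Sum>j\<in>I. \<bar>a j\<bar>\<^sup>2)))"
  proof (rule sum_indep_normal)
    show "I \<noteq> {}" using assms by (auto simp: I_def)
    show "indep_vars (\<lambda>_. borel) (\<lambda>j \<omega>. a j * \<omega> j) I"
      by (rule indep_vars_compose2[where Y="\<lambda>j t. a j * t"])
        (auto intro: indep_vars_subset[OF indep_vars_iid_normal])
    fix j assume "j \<in> I"
    then have "a j \<noteq> 0" by (simp add: I_def)
    then show "0 < \<bar>a j\<bar>" by simp
    show "distributed iid_normal lborel (\<lambda>\<omega>. a j * \<omega> j) (\<lambda>x. ennreal (normal_density 0 \<bar>a j\<bar> x))"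
      using normal_density_affine[OF distributed_iid_normal_component, of "a j" 0] \<open>a j \<noteq> 0\<close> by simp
  qed simp
  moreover have "(\<Sum>j\<in>I. a j * \<omega> j) = (\<Sum>j\<in>UNIV. a j * \<omega> j)" for \<omega>
    by (rule sum.mono_neutral_left) (auto simp: I_def)
  moreover have "(\<Sum>j\<in>I. \<bar>a j\<bar>\<^sup>2) = (\<Sum>j\<in>UNIV. (a j)\<^sup>2)"
    unfolding power2_abs by (rule sum.mono_neutral_left) (auto simp: I_def)
  ultimately show ?thesis by simp
qed

lemma second_moment_iid_normal:
  fixes a :: "'j::finite \<Rightarrow> real"
  shows "integrable iid_normal (\<lambda>\<omega>. (\<Sum>j\<in>UNIV. a j * \<omega> j)\<^sup>2)"
    and "(\<integral>\<omega>. (\<Sum>j\<in>UNIV. a j * \<omega> j)\<^sup>2 \<partial>iid_normal) = (\<Sum>j\<in>UNIV. (a j)\<^sup>2)"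
proof -
  have "integrable iid_normal (\<lambda>\<omega>. (\<Sum>j\<in>UNIV. a j * \<omega> j)\<^sup>2) \<and>
    (\<integral>\<omega>. (\<Sum>j\<in>UNIV. a j * \<omega> j)\<^sup>2 \<partial>iid_normal) = (\<Sum>j\<in>UNIV. (a j)\<^sup>2)"
  proof (cases "\<exists>j. a j \<noteq> 0")
    case True
    then obtain j where "a j \<noteq> 0" by blast
    note d = distributed_linear_iid_normal[of a, OF this]
    have pos: "(\<Sum>j\<in>UNIV. (a j)\<^sup>2) > 0"
      using \<open>a j \<noteq> 0\<close> by (intro sum_pos2[of _ j]) auto
    then have s: "sqrt (\<Sum>j\<in>UNIV. (a j)\<^sup>2) > 0" by simp
    show ?thesis
      using integrable_normal_moment[OF s, of 0 2] integral_normal_moment_even[OF s, of 0 1] pos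
      by (subst distributed_integrable[OF d, symmetric], simp, simp,
          subst distributed_integral[OF d, symmetric]) (auto simp: less_imp_le)
  qed simp
  then show "integrable iid_normal (\<lambda>\<omega>. (\<Sum>j\<in>UNIV. a j * \<omega> j)\<^sup>2)"
    "(\<integral>\<omega>. (\<Sum>j\<in>UNIV. a j * \<omega> j)\<^sup>2 \<partial>iid_normal) = (\<Sum>j\<in>UNIV. (a j)\<^sup>2)" by auto
qed

lemma covariance_iid_normal:
  fixes j k :: "'j::finite"
  shows "integrable iid_normal (\<lambda>\<omega>. \<omega> j * \<omega> k)"
    and "(\<integral>\<omega>. \<omega> j * \<omega> k \<partial>iid_normal) = of_bool (j = k)"
proof -
  \<comment> \<open>Coefficients of \<omega> j + r \<omega> k. The sum of indicators is also right
    for j = k, where the single coefficient is 1 + r.\<close>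
  define a :: "real \<Rightarrow> 'j \<Rightarrow> real" where "a r i = of_bool (i = j) + r * of_bool (i = k)" for r i
  have lin: "(\<Sum>i\<in>UNIV. a r i * \<omega> i) = \<omega> j + r * \<omega> k" for r \<omega>
    by (simp add: a_def distrib_right sum.distrib mult.assoc flip: sum_distrib_left)
  have nrm: "(\<Sum>i\<in>UNIV. (a r i)\<^sup>2) = 1 + 2 * r * of_bool (j = k) + r\<^sup>2" for r
  proof -
    have "(a r i)\<^sup>2 = of_bool (i = j) + 2 * r * of_bool (j = k) * of_bool (i = k) + r\<^sup>2 * of_bool (i = k)" for i
      by (simp add: a_def power2_eq_square algebra_simps)
    then show ?thesis by (simp add: sum.distrib flip: sum_distrib_left)
  qed
  note m = second_moment_iid_normal[of "a r" for r, unfolded lin nrm]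
  have eq: "\<omega> j * \<omega> k = ((\<omega> j + 1 * \<omega> k)\<^sup>2 - (\<omega> j + (-1) * \<omega> k)\<^sup>2) / 4" for \<omega> :: "'j \<Rightarrow> real"
    by (simp add: power2_eq_square algebra_simps)
  show "integrable iid_normal (\<lambda>\<omega>. \<omega> j * \<omega> k)"
    unfolding eq by (intro integrable_divide Bochner_Integration.integrable_diff m)
  show "(\<integral>\<omega>. \<omega> j * \<omega> k \<partial>iid_normal) = of_bool (j = k)"
    unfolding eq using m(1)[of 1] m(1)[of "-1"] m(2)[of 1] m(2)[of "-1"]
    by (simp del: mult_minus_left mult_1 minus_mult_left)
qed

lemma covariance_linear_iid_normal:
  fixes s t :: "'j::finite \<Rightarrow> complex"
  shows "(\<integral>\<omega>. (\<Sum>j\<in>UNIV. s j * of_real (\<omega> j)) * (\<Sum>j\<in>UNIV. t j * of_real (\<omega> j)) \<partial>iid_normal) = (\<Sum>j\<in>UNIV. s j * t j)"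
proof -
  have "(\<Sum>j\<in>UNIV. s j * of_real (\<omega> j)) * (\<Sum>j\<in>UNIV. t j * of_real (\<omega> j)) =
     (\<Sum>j\<in>UNIV. \<Sum>k\<in>UNIV. (s j * t k) * complex_of_real (\<omega> j * \<omega> k))" for \<omega>
    by (simp add: sum_product mult_ac)
  moreover have "integrable iid_normal (\<lambda>\<omega>. complex_of_real (\<omega> j * \<omega> k))" for j k :: 'j
    using covariance_iid_normal(1) by (rule integrable_of_real)
  moreover have "(\<integral>\<omega>. complex_of_real (\<omega> j * \<omega> k) \<partial>iid_normal) = of_bool (j = k)" for j k :: 'j
    using covariance_iid_normal(2)[of j k] by (simp only: integral_complex_of_real) simp
  ultimately show ?thesis
    by (simp del: of_real_mult)
qed

text \<open>The noise is real and only the coefficients are complex, so covariance and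
  pseudo-covariance are the two bilinear sums in the hypotheses.\<close>

lemma complex_gaussian_law_linear_iid_normal:
  fixes t :: "'i::finite \<Rightarrow> 'j::finite \<Rightarrow> complex"
  assumes pseudo: "\<And>i i'. (\<Sum>j\<in>UNIV. t i j * t i' j) = 0"
    and cov: "\<And>i i'. (\<Sum>j\<in>UNIV. t i j * cnj (t i' j)) = \<Lambda> $ i $ i'"
  shows "complex_gaussian_law \<Lambda> (distr iid_normal borel (\<lambda>\<omega>. \<chi> i. \<Sum>j\<in>UNIV. t i j * of_real (\<omega> j)))"
proof -
  interpret prob_space "iid_normal :: ('j \<Rightarrow> real) measure" by (rule prob_space_iid_normal)
  define F :: "('j \<Rightarrow> real) \<Rightarrow> complex ^ 'i" where "F \<omega> = (\<chi> i. \<Sum>j\<in>UNIV. t i j * of_real (\<omega> j))" for \<omega>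
  have F_nth: "F \<omega> $ i = (\<Sum>j\<in>UNIV. t i j * of_real (\<omega> j))" for \<omega> i
    by (simp add: F_def)
  have F_alt: "F \<omega> = (\<Sum>j\<in>UNIV. \<omega> j *\<^sub>R (\<chi> i. t i j))" for \<omega>
    by (simp add: vec_eq_iff F_nth) (simp add: scaleR_conv_of_real mult.commute)
  have F [measurable]: "F \<in> borel_measurable iid_normal"
    unfolding F_alt[abs_def] by measurable
  have nth [measurable]: "(\<lambda>x::complex^'i. x $ i) \<in> borel_measurable borel" for i
    by (intro borel_measurable_continuous_onI continuous_intros)
  have "centered_gaussian_law (distr iid_normal borel F)"
    unfolding centered_gaussian_law_def
  proof (intro conjI allI)
    show "prob_space (distr iid_normal borel F)" by (intro prob_space_distr F)
    fix c :: "complex ^ 'i"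
    define a where "a j = Re (\<Sum>i\<in>UNIV. c $ i * t i j)" for j
    have "(\<Sum>i\<in>UNIV. c $ i * F \<omega> $ i) = (\<Sum>j\<in>UNIV. of_real (\<omega> j) * (\<Sum>i\<in>UNIV. c $ i * t i j))" for \<omega>
      unfolding F_nth sum_distrib_left by (subst sum.swap) (simp add: mult_ac)
    then have eq: "Re (\<Sum>i\<in>UNIV. c $ i * F \<omega> $ i) = (\<Sum>j\<in>UNIV. a j * \<omega> j)" for \<omega>
      by (simp add: a_def mult.commute flip: of_real_mult)
    have [measurable]: "(\<lambda>x::complex^'i. Re (\<Sum>i\<in>UNIV. c $ i * x $ i)) \<in> borel_measurable borel"
      by (intro borel_measurable_continuous_onI continuous_intros)
    show "(AE x in distr iid_normal borel F. Re (\<Sum>i\<in>UNIV. c $ i * x $ i) = 0) \<or>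
      (\<exists>\<sigma>>0. distributed (distr iid_normal borel F) lborel (\<lambda>x. Re (\<Sum>i\<in>UNIV. c $ i * x $ i))
         (\<lambda>t. ennreal (normal_density 0 \<sigma> t)))"
    proof (cases "\<exists>j. a j \<noteq> 0")
      case False
      then show ?thesis by (intro disjI1, subst AE_distr_iff) (auto simp: eq simp del: Re_sum)
    next
      case True
      then obtain j where j: "a j \<noteq> 0" by blast
      then have "(\<Sum>j\<in>UNIV. (a j)\<^sup>2) > 0" by (intro sum_pos2[of _ j]) auto
      moreover have "distributed (distr iid_normal borel F) lborel (\<lambda>x. Re (\<Sum>i\<in>UNIV. c $ i * x $ i))
         (\<lambda>t. ennreal (normal_density 0 (sqrt (\<Sum>j\<in>UNIV. (a j)\<^sup>2)) t))"
        using distributed_linear_iid_normal[of a, OF j]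
        by (simp add: distributed_def distr_distr comp_def eq del: Re_sum)
      ultimately show ?thesis by (intro disjI2 exI conjI) auto
    qed
  qed simp
  moreover have "(\<integral>x. x $ i * x $ i' \<partial>distr iid_normal borel F) = 0" for i i'
    by (subst integral_distr)
      (auto intro!: borel_measurable_continuous_onI continuous_intros
        simp: F_nth covariance_linear_iid_normal pseudo)
  moreover have "(\<integral>x. x $ i * cnj (x $ i') \<partial>distr iid_normal borel F) = \<Lambda> $ i $ i'" for i i'
    by (subst integral_distr)
      (auto intro!: borel_measurable_continuous_onI continuous_intros
        simp: F_nth covariance_linear_iid_normal cov)
  ultimately show ?thesis
    unfolding complex_gaussian_law_def F_def[symmetric] by blast
qed

theorem complex_gaussian_law_exists:
  fixes T :: "complex ^ 'k::finite ^ 'i::finite"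
  shows "\<exists>\<mu>. complex_gaussian_law (T ** ctranspose T) \<mu>"
proof -
  \<comment> \<open>Each column of \<open>T\<close> is driven by a standard complex normal (g + i
    g') / sqrt 2. The factors 1 and i make the squares cancel, 1 + i^2 = 0, while the absolute
    squares add up to 2 / 2.\<close>
  define t where "t i = (\<lambda>(k, b). (if b then 1 else \<i>) * T $ i $ k / of_real (sqrt 2))" for i and b :: bool
  have sum_bool: "(\<Sum>j\<in>UNIV. f j) = (\<Sum>k\<in>UNIV. f (k, True) + f (k, False))" for f :: "'k \<times> bool \<Rightarrow> complex"
  proof -
    have "(\<Sum>j\<in>UNIV. f j) = (\<Sum>k\<in>UNIV. \<Sum>b\<in>UNIV. f (k, b))"
      by (simp only: sum.cartesian_product UNIV_Times_UNIV case_prod_eta)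
    then show ?thesis by (simp add: UNIV_bool add.commute)
  qed
  have sq: "complex_of_real (sqrt 2) * complex_of_real (sqrt 2) = 2"
    by (simp flip: of_real_mult)
  have "complex_gaussian_law (T ** ctranspose T)
     (distr iid_normal borel (\<lambda>\<omega>. \<chi> i. \<Sum>j\<in>UNIV. t i j * of_real (\<omega> j)))"
    by (rule complex_gaussian_law_linear_iid_normal)
      (auto simp: sum_bool t_def sq matrix_matrix_mult_def ctranspose_def field_simps intro!: sum.cong)
  then show ?thesis by blast
qed

text \<open>The only access to the chosen measure: a law exists, so the choice yields one.\<close>

lemma complex_gaussian_law_complex_gaussian:
  "complex_gaussian_law (T ** ctranspose T) (complex_gaussian (T ** ctranspose T))"
  unfolding complex_gaussian_def using complex_gaussian_law_exists by (rule someI_ex)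

section \<open>The conditional covariance matrix\<close>

lemma hdot_self: "hdot z z = of_real ((norm z)\<^sup>2)"
proof -
  have "(norm z)\<^sup>2 = (\<Sum>k\<in>UNIV. (cmod (z $ k))\<^sup>2)"
    by (simp add: norm_vec_def L2_set_def sum_nonneg)
  then show ?thesis
    by (simp only: hdot_def of_real_sum complex_norm_square)
qed

text \<open>Orthogonal projection onto the line of \<open>cnj w\<close>. The conjugate sits on the
  row index, as it does in \<open>matC\<close>.\<close>

definition line_proj :: "complex ^ 'm \<Rightarrow> 'm \<Rightarrow> 'm \<Rightarrow> complex" where
  "line_proj w q k = cnj (w $ q) * w $ k / of_real ((norm w)\<^sup>2)"

text \<open>The matrix acting as \<open>f\<close> on the line of \<open>cnj w\<close> and as \<open>e\<close> on its orthogonal complement.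
  All covariance blocks have this shape, so sums over coordinates reduce to the two eigenvalues.\<close>

definition proj_comb :: "complex ^ 'm \<Rightarrow> complex \<Rightarrow> complex \<Rightarrow> 'm \<Rightarrow> 'm \<Rightarrow> complex" where
  "proj_comb w e f q k = e * of_bool (q = k) + (f - e) * line_proj w q k"

lemma line_proj_trace:
  assumes "w \<noteq> 0"
  shows "(\<Sum>k\<in>UNIV. line_proj w k k) = 1"
proof -
  have "(\<Sum>k\<in>UNIV. cnj (w $ k) * w $ k) = of_real ((norm w)\<^sup>2)"
    unfolding hdot_self[symmetric] by (simp only: hdot_def mult.commute)
  then have "(\<Sum>k\<in>UNIV. line_proj w k k) = of_real ((norm w)\<^sup>2) / of_real ((norm w)\<^sup>2)"
    by (simp only: line_proj_def sum_divide_distrib[symmetric])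
  then show ?thesis
    using assms by simp
qed

lemma line_proj_idem:
  assumes "w \<noteq> 0"
  shows "(\<Sum>k\<in>UNIV. line_proj w q k * line_proj w k s) = line_proj w q s"
proof -
  have "line_proj w q k * line_proj w k s = line_proj w q s * line_proj w k k" for k
    by (simp add: line_proj_def)
  then show ?thesis
    using line_proj_trace[OF assms] by (simp flip: sum_distrib_left)
qed

text \<open>In e (I - P) + f P with P idempotent the two parts multiply separately, so products act
  eigenvalue by eigenvalue.\<close>

lemma proj_comb_mult:
  assumes "w \<noteq> 0"
  shows "(\<Sum>k\<in>UNIV. proj_comb w e f q k * proj_comb w e' f' k s) = proj_comb w (e * e') (f * f') q s"
proof -
  have "proj_comb w e f q k * proj_comb w e' f' k s =
     (if k = q then e * proj_comb w e' f' q s else 0)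
     + (if k = s then (f - e) * e' * line_proj w q s else 0)
     + (f - e) * (f' - e') * (line_proj w q k * line_proj w k s)" for k
    by (auto simp: proj_comb_def algebra_simps)
  then have "(\<Sum>k\<in>UNIV. proj_comb w e f q k * proj_comb w e' f' k s) =
     e * proj_comb w e' f' q s + (f - e) * e' * line_proj w q s + (f - e) * (f' - e') * line_proj w q s"
    by (simp only: sum.distrib sum_distrib_left[symmetric] line_proj_idem[OF assms] sum.delta finite UNIV_I if_True)
  then show ?thesis
    by (simp add: proj_comb_def algebra_simps)
qed

lemma proj_comb_trace:
  fixes w :: "complex ^ 'm"
  assumes "w \<noteq> 0"
  shows "(\<Sum>q\<in>UNIV. proj_comb w e f q q) = (of_nat CARD('m) - 1) * e + f"
  unfolding proj_comb_def sum.distrib sum_distrib_left[symmetric] line_proj_trace[OF assms]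
  by (simp add: algebra_simps)

lemma proj_comb_add: "proj_comb w e f q k + proj_comb w e' f' q k = proj_comb w (e + e') (f + f') q k"
  by (simp add: proj_comb_def algebra_simps)

lemma proj_comb_scale: "c * proj_comb w e f q k = proj_comb w (c * e) (c * f) q k"
  by (simp add: proj_comb_def algebra_simps)

lemma cnj_proj_comb: "cnj (proj_comb w e f q k) = proj_comb w (cnj e) (cnj f) k q"
  by (auto simp: proj_comb_def line_proj_def mult.commute)

lemma sum_UNIV_prod: "(\<Sum>x\<in>UNIV. f x) = (\<Sum>a\<in>UNIV. \<Sum>b\<in>UNIV. f (a, b))"
  by (simp only: sum.cartesian_product UNIV_Times_UNIV case_prod_eta)

lemma prod_UNIV_prod: "(\<Prod>x\<in>UNIV. f x) = (\<Prod>a\<in>UNIV. \<Prod>b\<in>UNIV. f (a, b))"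
  by (simp only: prod.cartesian_product UNIV_Times_UNIV case_prod_eta)

lemma matrix_matrix_mult_nth: "(A ** B) $ i $ k = (\<Sum>j\<in>UNIV. A $ i $ j * B $ j $ k)"
  by (simp add: matrix_matrix_mult_def)

section \<open>The Gram matrix of the two points; \<open>matA\<close> consists of two diagonal
  copies of it\<close>

definition gram :: "complex ^ 'm ^ 2 \<Rightarrow> 2 \<Rightarrow> 2 \<Rightarrow> complex" where
  "gram z p p' = exp (hdot (z $ p) (z $ p'))"

definition gram_det :: "complex ^ 'm ^ 2 \<Rightarrow> complex" where
  "gram_det z = gram z 1 1 * gram z 2 2 - gram z 1 2 * gram z 2 1"

text \<open>Adjugate over determinant.\<close>

definition gram_inv :: "complex ^ 'm ^ 2 \<Rightarrow> 2 \<Rightarrow> 2 \<Rightarrow> complex" where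
  "gram_inv z p p' = (if p \<noteq> p' then - gram z p p' else if p = 1 then gram z 2 2 else gram z 1 1) / gram_det z"

lemma gram_nz [simp]: "gram z p p' \<noteq> 0" by (simp add: gram_def)

lemma cnj_gram: "cnj (gram z p p') = gram z p' p"
  by (simp add: gram_def hdot_def exp_cnj mult.commute)

lemma gram_inv_right:
  assumes "gram_det z \<noteq> 0"
  shows "(\<Sum>r\<in>UNIV. gram z p r * gram_inv z r s) = of_bool (p = s)"
  using assms exhaust_2[of p] exhaust_2[of s]
  by (elim disjE) (simp_all add: sum_2 gram_inv_def gram_det_def divide_simps)

lemma matrix_inv_matA:
  assumes "gram_det z \<noteq> 0"
  shows "matrix_inv (matA z) = (\<chi> jp jp'. of_bool (fst jp = fst jp') * gram_inv z (snd jp) (snd jp'))"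
proof -
  let ?I = "\<chi> jp jp'. of_bool (fst jp = fst jp') * gram_inv z (snd jp) (snd jp')"
  have "(matA z ** ?I) $ (j, p) $ (j', p') = of_bool ((j, p) = (j', p'))" for j p j' p'
    using exhaust_2[of j] exhaust_2[of j']
    by (elim disjE) (simp_all add: matrix_matrix_mult_nth matA_def gram_def[symmetric] sum_UNIV_prod sum_2
        gram_inv_right[OF assms, unfolded sum_2])
  then have 1: "matA z ** ?I = mat 1"
    by (simp add: vec_eq_iff mat_def split_paired_all)
  then have 2: "?I ** matA z = mat 1"
    by (rule matrix_left_right_inverse[THEN iffD1])
  have "matrix_inv (matA z) = matrix_inv (matA z) ** (matA z ** ?I)"
    by (simp add: 1)
  also have "\<dots> = (matrix_inv (matA z) ** matA z) ** ?I"
    by (simp only: matrix_mul_assoc)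
  also have "matrix_inv (matA z) ** matA z = mat 1"
    \<comment> \<open>\<open>matrix_inv\<close> is a choice among two-sided inverses;
      \<open>?I\<close> shows that there is one.\<close>
    unfolding matrix_inv_def by (rule someI2[of _ ?I]) (simp_all only: 1 2)
  finally show ?thesis by simp
qed

text \<open>Gaussian elimination in each of the two equal diagonal blocks, read from the inside out:
  the first operation leaves the pivot D / E 1 1, the second clears the entry above it.\<close>

lemma det_matA:
  assumes "gram_det z \<noteq> 0"
  shows "det (matA z) = (gram_det z)\<^sup>2"
proof -
  define E where "E = gram z"
  define D where "D = gram_det z"
  have D: "D = E 1 1 * E 2 2 - E 1 2 * E 2 1" "D \<noteq> 0"
    using assms by (simp_all add: D_def E_def gram_det_def)
  have E: "E p p' \<noteq> 0" for p p' by (simp add: E_def)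
  define R :: "2 \<times> 2 \<Rightarrow> 2 \<times> 2 \<Rightarrow> complex \<Rightarrow> complex ^ (2 \<times> 2) ^ (2 \<times> 2) \<Rightarrow> complex ^ (2 \<times> 2) ^ (2 \<times> 2)"
    where "R i k c A = (\<chi> r. if r = i then row i A + c *s row k A else row r A)" for i k c A
  have det_R: "det (R i k c A) = det A" if "i \<noteq> k" for i k c A
    unfolding R_def using det_row_operation[OF that] .
  have R_nth: "R i k c A $ r $ s = (if r = i then A $ i $ s + c * A $ k $ s else A $ r $ s)" for i k c A r s
    by (simp add: R_def row_def)
  have E22: "E 2 2 = (D + E 1 2 * E 2 1) / E 1 1"
    using E by (simp add: D field_simps)
  define A where "A = R (1,1) (1,2) (- E 1 2 * E 1 1 / D) (R (1,2) (1,1) (- E 2 1 / E 1 1)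
     (R (2,1) (2,2) (- E 1 2 * E 1 1 / D) (R (2,2) (2,1) (- E 2 1 / E 1 1) (matA z))))"
  have matA_nth: "matA z $ (j, p) $ (j', p') = of_bool (j = j') * E p p'" for j p j' p'
    by (simp add: matA_def E_def gram_def)
  have A: "A $ (j, p) $ (j', p') =
      of_bool (j = j' \<and> p = p') * (if p = 1 then E 1 1 else D / E 1 1)" for j p j' p'
    using exhaust_2[of j] exhaust_2[of j'] exhaust_2[of p] exhaust_2[of p']
    by (elim disjE) (simp_all add: A_def R_nth matA_nth E22 E \<open>D \<noteq> 0\<close> add_divide_distrib)
  have "det (matA z) = det A"
    by (simp add: A_def det_R)
  also have "\<dots> = (\<Prod>i\<in>UNIV. A $ i $ i)"
    by (rule det_diagonal) (auto simp: A)
  also have "\<dots> = (\<Prod>j\<in>UNIV. \<Prod>p\<in>UNIV. A $ (j, p) $ (j, p))"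
    by (rule prod_UNIV_prod)
  also have "\<dots> = D\<^sup>2"
    using E by (simp only: A) (simp add: UNIV_2 power2_eq_square)
  finally show ?thesis by (simp add: D_def)
qed

text \<open>Conditioning changes the Gram entry only on the line of \<open>cnj w\<close>. With u =
  |w|^2 and x = exp (-u), the factor is 1 - u x / (1 - x) for p = p' and 1 - u / (1 - x)
  otherwise.\<close>

definition cond_eigenvalue :: "complex ^ 'm ^ 2 \<Rightarrow> 2 \<Rightarrow> 2 \<Rightarrow> complex" where
  "cond_eigenvalue z p p' = gram z p p' * (1 - of_real ((norm (z $ 1 - z $ 2))\<^sup>2) *
     (if p = p' then gram z 1 2 * gram z 2 1 else gram z 1 1 * gram z 2 2) / gram_det z)"

lemma matLambda_eq:
  assumes "gram_det z \<noteq> 0" and "z $ 1 \<noteq> z $ 2"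
  shows "matLambda z $ (j, p, q) $ (j', p', q') =
    of_bool (j = j') * proj_comb (z $ 1 - z $ 2) (gram z p p') (cond_eigenvalue z p p') q q'"
proof -
  have matB_nth: "matB z $ (j, p) $ (j', p', q') = of_bool (j = j') * (z $ p $ q' * gram z p p')" for j p j' p' q'
    by (simp add: matB_def gram_def)
  have 1: "(ctranspose (matB z) ** matrix_inv (matA z)) $ (j, p, q) $ (k, s) =
     of_bool (j = k) * (\<Sum>r\<in>UNIV. cnj (z $ r $ q) * gram z p r * gram_inv z r s)" for k s
    using exhaust_2[of j] exhaust_2[of k]
    by (auto simp: matrix_inv_matA[OF assms(1)] matrix_matrix_mult_nth ctranspose_def matB_nth cnj_gram sum_UNIV_prod sum_2)
  have "(ctranspose (matB z) ** matrix_inv (matA z) ** matB z) $ (j, p, q) $ (j', p', q') = of_bool (j = j') *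
      (\<Sum>s\<in>UNIV. (\<Sum>r\<in>UNIV. cnj (z $ r $ q) * gram z p r * gram_inv z r s) * (z $ s $ q' * gram z s p'))"
    using exhaust_2[of j] exhaust_2[of j']
    by (subst matrix_matrix_mult_nth) (auto simp: 1 sum_UNIV_prod sum_2 matB_nth)
  then have "matLambda z $ (j, p, q) $ (j', p', q') = of_bool (j = j') *
      ((of_bool (q = q') + cnj (z $ p' $ q) * z $ p $ q') * gram z p p' -
     (\<Sum>s\<in>UNIV. (\<Sum>r\<in>UNIV. cnj (z $ r $ q) * gram z p r * gram_inv z r s) * (z $ s $ q' * gram z s p')))"
    by (simp add: matLambda_def matC_def gram_def)
  \<comment> \<open>The source of translation invariance: the points enter both terms separately,
    yet the difference has rank one in (q, q') and depends on the coordinates through z^1 -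
    z^2.\<close>
  moreover have "cnj (z $ p' $ q) * z $ p $ q' * gram z p p' -
     (\<Sum>s\<in>UNIV. (\<Sum>r\<in>UNIV. cnj (z $ r $ q) * gram z p r * gram_inv z r s) * (z $ s $ q' * gram z s p')) =
     - (gram z p p' * (if p = p' then gram z 1 2 * gram z 2 1 else gram z 1 1 * gram z 2 2)
        * (cnj (z $ 1 $ q - z $ 2 $ q) * (z $ 1 $ q' - z $ 2 $ q'))) / gram_det z" (is "?x - ?S = - ?y / _")
  proof -
    \<comment> \<open>\<open>J\<close> is the adjugate. Clearing the determinant leaves a polynomial
      identity in coordinates and Gram entries, checked for each of the four pairs (p, p').\<close>
    define J where "J r s = gram_inv z r s * gram_det z" for r s
    have J: "J r s = (if r \<noteq> s then - gram z r s else if r = 1 then gram z 2 2 else gram z 1 1)" for r s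
      using assms(1) by (simp add: J_def gram_inv_def)
    have "?S * gram_det z =
      (\<Sum>s\<in>UNIV. (\<Sum>r\<in>UNIV. cnj (z $ r $ q) * gram z p r * J r s) * (z $ s $ q' * gram z s p'))"
      unfolding J_def by (simp add: sum_2 algebra_simps)
    moreover have "?x * gram_det z -
      (\<Sum>s\<in>UNIV. (\<Sum>r\<in>UNIV. cnj (z $ r $ q) * gram z p r * J r s) * (z $ s $ q' * gram z s p')) = - ?y"
      using exhaust_2[of p] exhaust_2[of p']
      by (elim disjE) (simp_all add: J sum_2 gram_det_def algebra_simps)
    ultimately have "(?x - ?S) * gram_det z = - ?y"
      by (simp only: left_diff_distrib)
    then show ?thesis
      by (simp only: nonzero_eq_divide_eq[OF assms(1)])
  qed
  ultimately have "matLambda z $ (j, p, q) $ (j', p', q') = of_bool (j = j') * (of_bool (q = q') * gram z p p' +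
      - (gram z p p' * (if p = p' then gram z 1 2 * gram z 2 1 else gram z 1 1 * gram z 2 2)
        * (cnj (z $ 1 $ q - z $ 2 $ q) * (z $ 1 $ q' - z $ 2 $ q'))) / gram_det z)"
    by (simp only: distrib_right add_diff_eq[symmetric])
  \<comment> \<open>\<open>U\<close> stands for |w|^2: this factor in \<open>cond_eigenvalue\<close>
    compensates the denominator of \<open>line_proj\<close>.\<close>
  moreover have aux: "d * g + - (g * k * (a * b)) / D = g * d + (g * (1 - U * k / D) - g) * (a * b / U)"
    if "U \<noteq> 0" "D \<noteq> 0" for a b d g k D U :: complex
    using that by (simp add: field_simps)
  ultimately show ?thesis
    using assms
    by (subst (asm) aux[of "of_real ((norm (z $ 1 - z $ 2))\<^sup>2)"])
      (simp_all add: proj_comb_def line_proj_def cond_eigenvalue_def)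
qed

section \<open>The expectation of the product of determinants\<close>

text \<open>The Gram determinant of the two rows. Factors are ordered section 1, 1, 2, 2 with every
  second one conjugated, the pattern of \<open>complex_gaussian_wick4\<close>.\<close>

lemma det_block_mult_ctranspose:
  "det (block a p ** ctranspose (block a p)) = (\<Sum>q\<in>UNIV. \<Sum>k\<in>UNIV.
     a $ (1, p, q) * cnj (a $ (1, p, q)) * a $ (2, p, k) * cnj (a $ (2, p, k)) -
     a $ (1, p, q) * cnj (a $ (1, p, k)) * a $ (2, p, k) * cnj (a $ (2, p, q)))"
  unfolding det_2 matrix_matrix_mult_nth sum_product sum_subtractf
  by (simp add: block_def ctranspose_def mult_ac)

lemma sum4_factor:
  fixes x y :: "'n::finite \<Rightarrow> 'n \<Rightarrow> complex"
  shows "(\<Sum>q\<in>UNIV. \<Sum>k\<in>UNIV. \<Sum>s\<in>UNIV. \<Sum>l\<in>UNIV. x q s * y k l) =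
    (\<Sum>q\<in>UNIV. \<Sum>s\<in>UNIV. x q s) * (\<Sum>k\<in>UNIV. \<Sum>l\<in>UNIV. y k l)"
  unfolding sum_product ..

lemma proj_comb_trace_mult:
  fixes w :: "complex ^ 'm"
  assumes "w \<noteq> 0"
  shows "(\<Sum>q\<in>UNIV. \<Sum>k\<in>UNIV. proj_comb w e f q k * proj_comb w e' f' k q) =
    (of_nat CARD('m) - 1) * (e * e') + f * f'"
  by (simp add: proj_comb_mult[OF assms] proj_comb_trace[OF assms])

text \<open>The four sums are the contributions of the four products of permutations in the expansion of
  the two \<open>2 \<times> 2\<close> determinants; \<open>G\<close> is the fourth-order moment of a single section.\<close>

lemma wick_sums:
  fixes w :: "complex ^ 'm" and e f :: "2 \<Rightarrow> 2 \<Rightarrow> complex"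
  assumes w: "w \<noteq> 0"
  defines "L \<equiv> \<lambda>p p'. proj_comb w (e p p') (f p p')"
  defines "G \<equiv> \<lambda>i k s l. L 1 1 i k * L 2 2 s l + L 1 2 i l * L 2 1 s k"
  defines "tr \<equiv> \<lambda>x y. (of_nat CARD('m) - 1) * x + y :: complex"
  shows "(\<Sum>q\<in>UNIV. \<Sum>k\<in>UNIV. \<Sum>s\<in>UNIV. \<Sum>l\<in>UNIV. G q q s s * G k k l l) =
      (tr (e 1 1) (f 1 1) * tr (e 2 2) (f 2 2) + tr (e 1 2 * e 2 1) (f 1 2 * f 2 1))\<^sup>2" (is ?S1)
    and "(\<Sum>q\<in>UNIV. \<Sum>k\<in>UNIV. \<Sum>s\<in>UNIV. \<Sum>l\<in>UNIV. G q q s l * G k k l s) =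
      tr ((tr (e 1 1) (f 1 1) * e 2 2 + e 2 1 * e 1 2)\<^sup>2) ((tr (e 1 1) (f 1 1) * f 2 2 + f 2 1 * f 1 2)\<^sup>2)" (is ?S2)
    and "(\<Sum>q\<in>UNIV. \<Sum>k\<in>UNIV. \<Sum>s\<in>UNIV. \<Sum>l\<in>UNIV. G q k s s * G k q l l) =
      tr ((tr (e 2 2) (f 2 2) * e 1 1 + e 1 2 * e 2 1)\<^sup>2) ((tr (e 2 2) (f 2 2) * f 1 1 + f 1 2 * f 2 1)\<^sup>2)" (is ?S3)
    and "(\<Sum>q\<in>UNIV. \<Sum>k\<in>UNIV. \<Sum>s\<in>UNIV. \<Sum>l\<in>UNIV. G q k s l * G k q l s) =
      tr ((e 1 1)\<^sup>2) ((f 1 1)\<^sup>2) * tr ((e 2 2)\<^sup>2) ((f 2 2)\<^sup>2)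
      + 2 * tr (e 1 1 * e 1 2 * e 2 2 * e 2 1) (f 1 1 * f 1 2 * f 2 2 * f 2 1)
      + (tr (e 1 2 * e 2 1) (f 1 2 * f 2 1))\<^sup>2" (is ?S4)
proof -
  note mult = proj_comb_mult[OF w] and trace = proj_comb_trace[OF w]
  note trace2 = proj_comb_trace_mult[OF w]
  have 1: "(\<Sum>q\<in>UNIV. \<Sum>s\<in>UNIV. G q q s s) =
      tr (e 1 1) (f 1 1) * tr (e 2 2) (f 2 2) + tr (e 1 2 * e 2 1) (f 1 2 * f 2 1)"
    unfolding G_def L_def tr_def sum.distrib trace2
    by (simp only: sum_product[symmetric] trace)
  show ?S1
    unfolding sum4_factor 1 power2_eq_square ..
  have 2: "(\<Sum>q\<in>UNIV. G q q s l) =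
      proj_comb w (tr (e 1 1) (f 1 1) * e 2 2 + e 2 1 * e 1 2) (tr (e 1 1) (f 1 1) * f 2 2 + f 2 1 * f 1 2) s l" for s l
  proof -
    have "(\<Sum>q\<in>UNIV. G q q s l) = (\<Sum>q\<in>UNIV. L 1 1 q q) * L 2 2 s l + (\<Sum>q\<in>UNIV. L 2 1 s q * L 1 2 q l)"
      by (simp add: G_def sum.distrib sum_distrib_right mult.commute)
    then show ?thesis
      by (simp only: L_def tr_def trace mult) (simp only: proj_comb_scale proj_comb_add)
  qed
  \<comment> \<open>In the second sum the contractions run over q and k, so these indices have to
    become the inner ones.\<close>
  have swap: "(\<Sum>q\<in>UNIV. \<Sum>k\<in>UNIV. \<Sum>s\<in>UNIV. \<Sum>l\<in>UNIV. X q k s l) =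
      (\<Sum>s\<in>UNIV. \<Sum>l\<in>UNIV. \<Sum>q\<in>UNIV. \<Sum>k\<in>UNIV. X q k s l)" for X :: "'m \<Rightarrow> 'm \<Rightarrow> 'm \<Rightarrow> 'm \<Rightarrow> complex"
  proof -
    have "(\<Sum>q\<in>UNIV. \<Sum>k\<in>UNIV. \<Sum>s\<in>UNIV. \<Sum>l\<in>UNIV. X q k s l) =
        (\<Sum>x\<in>UNIV. \<Sum>y\<in>UNIV. X (fst x) (snd x) (fst y) (snd y))"
      by (simp add: sum_UNIV_prod)
    also have "\<dots> = (\<Sum>y\<in>UNIV. \<Sum>x\<in>UNIV. X (fst x) (snd x) (fst y) (snd y))"
      by (rule sum.swap)
    finally show ?thesis by (simp add: sum_UNIV_prod)
  qed
  show ?S2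
    by (simp only: swap sum_product[symmetric] 2 trace2) (simp only: tr_def power2_eq_square)
  have 3: "(\<Sum>s\<in>UNIV. G q k s s) =
      proj_comb w (tr (e 2 2) (f 2 2) * e 1 1 + e 1 2 * e 2 1) (tr (e 2 2) (f 2 2) * f 1 1 + f 1 2 * f 2 1) q k" for q k
  proof -
    have "(\<Sum>s\<in>UNIV. G q k s s) = (\<Sum>s\<in>UNIV. L 2 2 s s) * L 1 1 q k + (\<Sum>s\<in>UNIV. L 1 2 q s * L 2 1 s k)"
      by (simp add: G_def sum.distrib sum_distrib_left mult.commute)
    then show ?thesis
      by (simp only: L_def tr_def trace mult) (simp only: proj_comb_scale proj_comb_add)
  qed
  show ?S3
    by (simp only: sum_product[symmetric] 3 trace2) (simp only: tr_def power2_eq_square)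
  \<comment> \<open>Each product of two pairings closes into index cycles: two 2-cycles in the first
    and last terms, a single 4-cycle in each mixed term.\<close>
  have 4: "G q k s l * G k q l s = (L 1 1 q k * L 1 1 k q) * (L 2 2 s l * L 2 2 l s)
     + L 1 1 q k * (L 1 2 k s * (L 2 2 s l * L 2 1 l q))
     + L 1 1 k q * (L 1 2 q l * (L 2 2 l s * L 2 1 s k))
     + (L 1 2 q l * L 2 1 l q) * (L 1 2 k s * L 2 1 s k)" for q k s l
    by (simp add: G_def algebra_simps)
  have A: "(\<Sum>q\<in>UNIV. \<Sum>k\<in>UNIV. \<Sum>s\<in>UNIV. \<Sum>l\<in>UNIV. (L 1 1 q k * L 1 1 k q) * (L 2 2 s l * L 2 2 l s)) =
     tr ((e 1 1)\<^sup>2) ((f 1 1)\<^sup>2) * tr ((e 2 2)\<^sup>2) ((f 2 2)\<^sup>2)"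
    by (simp only: sum_distrib_left[symmetric] sum_distrib_right[symmetric])
      (simp only: L_def trace2 tr_def power2_eq_square)
  have B: "(\<Sum>q\<in>UNIV. \<Sum>k\<in>UNIV. \<Sum>s\<in>UNIV. \<Sum>l\<in>UNIV. L 1 1 q k * (L 1 2 k s * (L 2 2 s l * L 2 1 l q))) =
     tr (e 1 1 * e 1 2 * e 2 2 * e 2 1) (f 1 1 * f 1 2 * f 2 2 * f 2 1)"
    by (simp only: sum_distrib_left[symmetric]) (simp only: L_def mult trace tr_def mult.assoc)
  \<comment> \<open>The cycle of \<open>B\<close> after exchanging q with k and s with l; together
    they give the coefficient 2.\<close>
  have C: "(\<Sum>q\<in>UNIV. \<Sum>k\<in>UNIV. \<Sum>s\<in>UNIV. \<Sum>l\<in>UNIV. L 1 1 k q * (L 1 2 q l * (L 2 2 l s * L 2 1 s k))) =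
     tr (e 1 1 * e 1 2 * e 2 2 * e 2 1) (f 1 1 * f 1 2 * f 2 2 * f 2 1)"
    unfolding B[symmetric] by (subst sum.swap, rule sum.cong[OF refl], rule sum.cong[OF refl], rule sum.swap)
  have D: "(\<Sum>q\<in>UNIV. \<Sum>k\<in>UNIV. \<Sum>s\<in>UNIV. \<Sum>l\<in>UNIV. (L 1 2 q l * L 2 1 l q) * (L 1 2 k s * L 2 1 s k)) =
     (tr (e 1 2 * e 2 1) (f 1 2 * f 2 1))\<^sup>2"
    by (subst sum.swap[of _ UNIV UNIV], simp only: sum_distrib_left[symmetric] sum_distrib_right[symmetric])
      (simp only: L_def mult trace tr_def power2_eq_square)
  show ?S4
    unfolding 4 sum.distrib A B C D by simp
qed

lemma complex_gaussian_expectation_dets: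
  fixes w :: "complex ^ 'm" and e f :: "2 \<Rightarrow> 2 \<Rightarrow> complex"
  assumes law: "complex_gaussian_law \<Lambda> \<mu>" and w: "w \<noteq> 0"
    and \<Lambda>: "\<And>j p q j' p' q'. \<Lambda> $ (j, p, q) $ (j', p', q') = of_bool (j = j') * proj_comb w (e p p') (f p p') q q'"
  defines "tr \<equiv> \<lambda>x y. (of_nat CARD('m) - 1) * x + y :: complex"
  shows "(\<integral>a. det (block a 1 ** ctranspose (block a 1)) * det (block a 2 ** ctranspose (block a 2)) \<partial>\<mu>) =
      (tr (e 1 1) (f 1 1) * tr (e 2 2) (f 2 2) + tr (e 1 2 * e 2 1) (f 1 2 * f 2 1))\<^sup>2
      - tr ((tr (e 1 1) (f 1 1) * e 2 2 + e 2 1 * e 1 2)\<^sup>2) ((tr (e 1 1) (f 1 1) * f 2 2 + f 2 1 * f 1 2)\<^sup>2)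
      - tr ((tr (e 2 2) (f 2 2) * e 1 1 + e 1 2 * e 2 1)\<^sup>2) ((tr (e 2 2) (f 2 2) * f 1 1 + f 1 2 * f 2 1)\<^sup>2)
      + (tr ((e 1 1)\<^sup>2) ((f 1 1)\<^sup>2) * tr ((e 2 2)\<^sup>2) ((f 2 2)\<^sup>2)
        + 2 * tr (e 1 1 * e 1 2 * e 2 2 * e 2 1) (f 1 1 * f 1 2 * f 2 2 * f 2 1)
        + (tr (e 1 2 * e 2 1) (f 1 2 * f 2 1))\<^sup>2)"
proof -
  define G where "G = (\<lambda>i k s l. proj_comb w (e 1 1) (f 1 1) i k * proj_comb w (e 2 2) (f 2 2) s l
     + proj_comb w (e 1 2) (f 1 2) i l * proj_comb w (e 2 1) (f 2 1) s k)"
  \<comment> \<open>The eight factors, grouped by point in the determinants, are regrouped by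
    section: a section is correlated between its two points, but not with the other section.\<close>
  define Q :: "2 \<Rightarrow> 'm \<Rightarrow> 'm \<Rightarrow> 'm \<Rightarrow> 'm \<Rightarrow> complex ^ (2 \<times> 2 \<times> 'm) \<Rightarrow> complex"
    where "Q j q k s l a = a $ (j, 1, q) * cnj (a $ (j, 1, k)) * a $ (j, 2, s) * cnj (a $ (j, 2, l))" for j q k s l a
  have Q: "integrable \<mu> (\<lambda>a. Q 1 q k s l a * Q 2 q' k' s' l' a)"
    "(\<integral>a. Q 1 q k s l a * Q 2 q' k' s' l' a \<partial>\<mu>) = G q k s l * G q' k' s' l'" for q k s l q' k' s' l'
    using complex_gaussian_prod8_uncorrelated[OF law, of "{1} \<times> UNIV" "{2} \<times> UNIV"
      "(1, 1, q)" "(1, 1, k)" "(1, 2, s)" "(1, 2, l)" "(2, 1, q')" "(2, 1, k')" "(2, 2, s')" "(2, 2, l')"]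
    by (auto simp: \<Lambda> Q_def G_def)
  have "(\<lambda>a. det (block a 1 ** ctranspose (block a 1)) * det (block a 2 ** ctranspose (block a 2))) =
    (\<lambda>a. \<Sum>q\<in>UNIV. \<Sum>k\<in>UNIV. \<Sum>s\<in>UNIV. \<Sum>l\<in>UNIV.
      Q 1 q q s s a * Q 2 k k l l a - Q 1 q q s l a * Q 2 k k l s a
      - Q 1 q k s s a * Q 2 k q l l a + Q 1 q k s l a * Q 2 k q l s a)"
    unfolding det_block_mult_ctranspose
    by (simp only: sum_distrib_right, simp only: sum_distrib_left)
      (auto simp: Q_def algebra_simps intro!: ext sum.cong)
  then have "(\<integral>a. det (block a 1 ** ctranspose (block a 1)) * det (block a 2 ** ctranspose (block a 2)) \<partial>\<mu>) =
    (\<Sum>q\<in>UNIV. \<Sum>k\<in>UNIV. \<Sum>s\<in>UNIV. \<Sum>l\<in>UNIV. G q q s s * G k k l l - G q q s l * G k k l s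
      - G q k s s * G k q l l + G q k s l * G k q l s)"
    by (simp add: Q)
  then show ?thesis
    by (simp only: sum.distrib sum_subtractf) (simp only: G_def wick_sums[OF w] tr_def)
qed

section \<open>Positivity of the conditional covariance\<close>

text \<open>With T(v) = 1 + v + v^2 / 2 one has exp v \<ge> T(v), and T(v) T(-v) = 1 + v^4 / 4 \<ge>
  1 turns this into exp (-v) \<le> T(-v). The difference T(v) - T(-v) is 2v.\<close>

lemma two_le_exp_minus_exp_neg:
  assumes "0 \<le> (v::real)"
  shows "2 * v \<le> exp v - exp (- v)"
proof -
  have "1 + v + v\<^sup>2 / 2 \<le> exp v"
    by (rule exp_lower_Taylor_quadratic[OF assms])
  moreover have "exp (- v) \<le> 1 - v + v\<^sup>2 / 2"
  proof -
    have "1 \<le> 1 + v ^ 4 / 4" by simp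
    also have "\<dots> = (1 - v + v\<^sup>2 / 2) * (1 + v + v\<^sup>2 / 2)"
      by (simp add: power2_eq_square power4_eq_xxxx algebra_simps)
    also have "\<dots> \<le> (1 - v + v\<^sup>2 / 2) * exp v"
    proof (rule mult_left_mono)
      have "0 \<le> (1 - v)\<^sup>2 + 1" by simp
      then show "0 \<le> 1 - v + v\<^sup>2 / 2" by (simp add: power2_eq_square algebra_simps)
    qed fact
    finally show ?thesis by (simp add: exp_minus field_simps)
  qed
  ultimately show ?thesis by linarith
qed

text \<open>With \<open>v = u/2\<close> and \<open>y = exp (-v)\<close>, the difference of the square roots of the two sides of the
  last inequality is a positive multiple of \<open>(1 + y) (1 - y\<^sup>2 - 2 v y)\<close>, that is, of \<open>sinh v - v\<close>.\<close>

lemma cond_eigenvalue_bounds: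
  fixes u :: real
  assumes "0 < u"
  defines "x \<equiv> exp (- u)"
  shows "0 < 1 - u * x / (1 - x)" and "x * (1 - u / (1 - x))\<^sup>2 \<le> (1 - u * x / (1 - x))\<^sup>2"
proof -
  have x: "0 < x" "x < 1" using assms by (simp_all add: x_def)
  have "1 + u < exp u"
    using exp_lower_Taylor_quadratic[of u] assms by (smt (verit) zero_less_power half_gt_zero)
  then have "(1 + u) * x < exp u * x" using x by simp
  then have h: "u * x < 1 - x" by (simp add: x_def exp_minus algebra_simps)
  then show pos: "0 < 1 - u * x / (1 - x)" using x by (simp add: field_simps)
  define v y where "v = u / 2" and "y = exp (- v)"
  have y: "0 < y" "y * y = x" by (simp_all add: y_def v_def x_def flip: exp_add)
  have "2 * v * y \<le> (exp v - exp (- v)) * y"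
    using two_le_exp_minus_exp_neg[of v] assms y by (intro mult_right_mono) (auto simp: v_def)
  also have "\<dots> = 1 - x"
    using y by (simp add: left_diff_distrib) (simp add: y_def flip: exp_add)
  finally have "0 \<le> (1 + y) * (1 - x - 2 * v * y)" using y by simp
  also have "\<dots> = (1 - x - u * x) - y * (u - (1 - x))"
    by (simp add: v_def algebra_simps y(2)[symmetric])
  finally have "y * (u - (1 - x)) \<le> 1 - x - u * x" by simp
  moreover have "0 \<le> y * (u - (1 - x))"
  proof -
    have "1 - u \<le> x" unfolding x_def using exp_ge_add_one_self[of "- u"] by simp
    then show ?thesis using y by simp
  qed
  ultimately have "(y * (u - (1 - x)))\<^sup>2 \<le> (1 - x - u * x)\<^sup>2"
    by (intro power_mono)
  then have "x * (u - (1 - x))\<^sup>2 / (1 - x)\<^sup>2 \<le> (1 - x - u * x)\<^sup>2 / (1 - x)\<^sup>2"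
    by (intro divide_right_mono) (simp_all add: power_mult_distrib power2_eq_square[of y] y)
  moreover have "(1 - u / (1 - x))\<^sup>2 = (u - (1 - x))\<^sup>2 / (1 - x)\<^sup>2"
    using x by (simp add: power_divide[symmetric] diff_divide_distrib power2_commute)
  moreover have "(1 - u * x / (1 - x))\<^sup>2 = (1 - x - u * x)\<^sup>2 / (1 - x)\<^sup>2"
    using x by (simp add: power_divide[symmetric] diff_divide_distrib)
  ultimately show "x * (1 - u / (1 - x))\<^sup>2 \<le> (1 - u * x / (1 - x))\<^sup>2" by simp
qed

text \<open>An explicit Cholesky factor. \<gamma> is the Schur complement and may be zero; \<alpha>
  is divided by and has to be positive.\<close>

lemma hermitian_2x2_factor:
  fixes F :: "2 \<Rightarrow> 2 \<Rightarrow> complex"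
  assumes F: "F 1 1 = of_real \<alpha>" "F 2 2 = of_real \<beta>" "F 2 1 = cnj (F 1 2)"
    and pos: "0 < \<alpha>" "(cmod (F 1 2))\<^sup>2 \<le> \<alpha> * \<beta>"
  shows "\<exists>R :: 2 \<Rightarrow> 2 \<Rightarrow> complex. \<forall>p p'. (\<Sum>r\<in>UNIV. R p r * cnj (R p' r)) = F p p'"
proof -
  define \<gamma> where "\<gamma> = \<beta> - (cmod (F 1 2))\<^sup>2 / \<alpha>"
  have "0 \<le> \<gamma>" using pos by (simp add: \<gamma>_def field_simps)
  define R :: "2 \<Rightarrow> 2 \<Rightarrow> complex" where
    "R p r = (if p = 1 then (if r = 1 then of_real (sqrt \<alpha>) else 0)
       else if r = 1 then cnj (F 1 2) / of_real (sqrt \<alpha>) else of_real (sqrt \<gamma>))" for p r :: 2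
  have sq: "complex_of_real (sqrt \<alpha>) * complex_of_real (sqrt \<alpha>) = of_real \<alpha>"
    "complex_of_real (sqrt \<gamma>) * complex_of_real (sqrt \<gamma>) = of_real \<gamma>"
    using pos \<open>0 \<le> \<gamma>\<close> by (simp_all flip: of_real_mult)
  have n: "F 1 2 * cnj (F 1 2) = of_real ((cmod (F 1 2))\<^sup>2)"
    by (simp only: complex_norm_square)
  have nz: "\<alpha> \<noteq> 0" using pos by simp
  have "cnj (F 1 2) * F 1 2 / of_real \<alpha> + of_real \<gamma> = of_real \<beta>"
    unfolding mult.commute[of "cnj _"] n \<gamma>_def by simp
  then have "(\<Sum>r\<in>UNIV. R p r * cnj (R p' r)) = F p p'" for p p'
    using exhaust_2[of p] exhaust_2[of p'] nz
    by (elim disjE) (simp_all add: sum_2 R_def F sq)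
  then show ?thesis by blast
qed

text \<open>The factor \<open>T\<close> is assembled from \<open>S\<close> on the complement and
  \<open>R\<close> on the line; as eigenvalues multiply separately, \<open>T ** ctranspose T\<close>
  has exactly the blocks of \<Lambda>.\<close>

lemma complex_gaussian_law_proj_comb:
  fixes w :: "complex ^ 'm" and \<Lambda> :: "complex ^ (2 \<times> 2 \<times> 'm) ^ (2 \<times> 2 \<times> 'm)"
    and e f S R :: "2 \<Rightarrow> 2 \<Rightarrow> complex"
  assumes w: "w \<noteq> 0"
    and \<Lambda>: "\<And>j p q j' p' q'. \<Lambda> $ (j, p, q) $ (j', p', q') = of_bool (j = j') * proj_comb w (e p p') (f p p') q q'"
    and e: "\<And>p p'. (\<Sum>r\<in>UNIV. S p r * cnj (S p' r)) = e p p'"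
    and f: "\<And>p p'. (\<Sum>r\<in>UNIV. R p r * cnj (R p' r)) = f p p'"
  shows "complex_gaussian_law \<Lambda> (complex_gaussian \<Lambda>)"
proof -
  define T :: "complex ^ (2 \<times> 2 \<times> 'm) ^ (2 \<times> 2 \<times> 'm)"
    where "T = (\<chi> x y. case (x, y) of ((j, p, q), (j', r, s)) \<Rightarrow> of_bool (j = j') * proj_comb w (S p r) (R p r) q s)"
  have "(T ** ctranspose T) $ (j, p, q) $ (j', p', q') = \<Lambda> $ (j, p, q) $ (j', p', q')" for j p q j' p' q'
  proof -
    have "(T ** ctranspose T) $ (j, p, q) $ (j', p', q') =
      of_bool (j = j') * (\<Sum>r\<in>UNIV. \<Sum>s\<in>UNIV.
        proj_comb w (S p r) (R p r) q s * proj_comb w (cnj (S p' r)) (cnj (R p' r)) s q')"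
      using exhaust_2[of j] exhaust_2[of j']
      by (elim disjE) (simp_all add: matrix_matrix_mult_nth sum_UNIV_prod T_def ctranspose_def cnj_proj_comb sum_2[of "\<lambda>a. \<Sum>b\<in>UNIV. \<Sum>c\<in>UNIV. _ a b c"])
    then show ?thesis
      by (simp add: \<Lambda> sum_2 proj_comb_mult[OF w] proj_comb_add e[symmetric] f[symmetric])
  qed
  then have "\<Lambda> = T ** ctranspose T"
    by (simp add: vec_eq_iff split_paired_all)
  then show ?thesis
    using complex_gaussian_law_complex_gaussian[of T] by simp
qed

section \<open>Evaluation of the pair correlation function\<close>

text \<open>Here X stands for exp u and g for u / (X - 1), which makes the eigenvalue factors 1 - g
  and 1 - g X. Multiplication by X^2 clears x = 1 / X, and a polynomial identity in M, X, g
  remains.\<close>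

lemma kappa2_numerator:
  fixes M X g :: real
  assumes "X \<noteq> 0"
  defines "n \<equiv> M - 1" and "x \<equiv> 1 / X" and "y \<equiv> 1 - g" and "y' \<equiv> 1 - g * X"
  defines "t \<equiv> n + y" and "\<tau> \<equiv> n * x + x * y'\<^sup>2"
  shows "X\<^sup>2 * ((t * t + \<tau>)\<^sup>2 - (n * (t + x)\<^sup>2 + (t * y + x * y'\<^sup>2)\<^sup>2)
      - (n * (t + x)\<^sup>2 + (t * y + x * y'\<^sup>2)\<^sup>2)
      + ((n + y\<^sup>2) * (n + y\<^sup>2) + 2 * (n * x + y\<^sup>2 * (x * y'\<^sup>2)) + \<tau>\<^sup>2)) =
    M * (M - 1) * ((M\<^sup>2 - M) * X\<^sup>2 + 2 * (M - 1) * X + 2)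
      - 4 * g * X * ((M - 1) * X + 1) * (M + 1) * (M - 1)
      + 2 * g\<^sup>2 * X * ((M - 1) * X\<^sup>2 + 2 * M * X + 1) * (M - 1)"
proof -
  \<comment> \<open>One factor X goes into each base, by X \<tau> = n + y'^2 and X x = 1, so the
    final expansion is free of divisions.\<close>
  have *: "X\<^sup>2 * (a + \<tau>)\<^sup>2 = (X * a + (n + y'\<^sup>2))\<^sup>2" "X\<^sup>2 * (a + x)\<^sup>2 = (X * a + 1)\<^sup>2"
    "X\<^sup>2 * (a + x * b)\<^sup>2 = (X * a + b)\<^sup>2" "X\<^sup>2 * \<tau>\<^sup>2 = (n + y'\<^sup>2)\<^sup>2"
    "X\<^sup>2 * (n * x + b * (x * c)) = X * (n + b * c)" for a b c
    using assms(1) by (simp_all add: x_def \<tau>_def power2_eq_square field_simps)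
  have "X\<^sup>2 * ((t * t + \<tau>)\<^sup>2 - (n * (t + x)\<^sup>2 + (t * y + x * y'\<^sup>2)\<^sup>2)
      - (n * (t + x)\<^sup>2 + (t * y + x * y'\<^sup>2)\<^sup>2)
      + ((n + y\<^sup>2) * (n + y\<^sup>2) + 2 * (n * x + y\<^sup>2 * (x * y'\<^sup>2)) + \<tau>\<^sup>2)) =
    X\<^sup>2 * (t * t + \<tau>)\<^sup>2 - 2 * (n * (X\<^sup>2 * (t + x)\<^sup>2) + X\<^sup>2 * (t * y + x * y'\<^sup>2)\<^sup>2)
      + (X\<^sup>2 * ((n + y\<^sup>2) * (n + y\<^sup>2)) + 2 * (X\<^sup>2 * (n * x + y\<^sup>2 * (x * y'\<^sup>2))) + X\<^sup>2 * \<tau>\<^sup>2)"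
    by (simp add: algebra_simps)
  also have "\<dots> = (X * (t * t) + (n + y'\<^sup>2))\<^sup>2 - 2 * (n * (X * t + 1)\<^sup>2 + (X * (t * y) + y'\<^sup>2)\<^sup>2)
      + (X\<^sup>2 * ((n + y\<^sup>2) * (n + y\<^sup>2)) + 2 * (X * (n + y\<^sup>2 * y'\<^sup>2)) + (n + y'\<^sup>2)\<^sup>2)"
    by (simp only: *)
  also have "\<dots> = M * (M - 1) * ((M\<^sup>2 - M) * X\<^sup>2 + 2 * (M - 1) * X + 2)
      - 4 * g * X * ((M - 1) * X + 1) * (M + 1) * (M - 1)
      + 2 * g\<^sup>2 * X * ((M - 1) * X\<^sup>2 + 2 * M * X + 1) * (M - 1)"
    unfolding t_def n_def y_def y'_def by (simp add: power2_eq_square) (simp add: algebra_simps)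
  finally show ?thesis .
qed

lemma kappa2_eq:
  fixes u :: real
  assumes m: "2 \<le> m" and u: "0 < u"
  defines "M \<equiv> real m" and "x \<equiv> exp (- u)"
  defines "n \<equiv> M - 1" and "y \<equiv> 1 - u * x / (1 - x)" and "y' \<equiv> 1 - u / (1 - x)"
  defines "t \<equiv> n + y" and "\<tau> \<equiv> n * x + x * y'\<^sup>2"
  assumes r: "r\<^sup>2 = u"
  shows "((t * t + \<tau>)\<^sup>2 - (n * (t + x)\<^sup>2 + (t * y + x * y'\<^sup>2)\<^sup>2)
      - (n * (t + x)\<^sup>2 + (t * y + x * y'\<^sup>2)\<^sup>2)
      + ((n + y\<^sup>2) * (n + y\<^sup>2) + 2 * (n * x + y\<^sup>2 * (x * y'\<^sup>2)) + \<tau>\<^sup>2)) / ((1 - x)\<^sup>2 * (M * (M - 1))\<^sup>2) =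
    kappa2 m r" (is "?N / _ = _")
proof -
  define X where "X = exp u"
  define g where "g = u / (X - 1)"
  have X: "X > 1" using u by (simp add: X_def)
  have x: "x = 1 / X" by (simp add: x_def X_def exp_minus inverse_eq_divide)
  have u_eq: "u = g * (X - 1)" using X by (simp add: g_def)
  have y: "y = 1 - g" "y' = 1 - g * X"
    using X by (simp_all add: y_def y'_def g_def x field_simps)
  have M: "M \<noteq> 0" "M - 1 \<noteq> 0" using m by (auto simp: M_def)
  have X': "X \<noteq> 0" "X - 1 \<noteq> 0" using X by auto
  have num: "X\<^sup>2 * ?N = M * (M - 1) * ((M\<^sup>2 - M) * X\<^sup>2 + 2 * (M - 1) * X + 2)
      - 4 * g * X * ((M - 1) * X + 1) * (M + 1) * (M - 1)
      + 2 * g\<^sup>2 * X * ((M - 1) * X\<^sup>2 + 2 * M * X + 1) * (M - 1)"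
    unfolding t_def \<tau>_def n_def y x by (rule kappa2_numerator[OF X'(1)])
  have "?N / ((1 - x)\<^sup>2 * (M * (M - 1))\<^sup>2) = X\<^sup>2 * ?N / ((X - 1)\<^sup>2 * (M * (M - 1))\<^sup>2)"
  proof -
    have "(1 - x)\<^sup>2 = (X - 1)\<^sup>2 / X\<^sup>2"
      using X' by (simp add: x power_divide[symmetric] diff_divide_distrib)
    then show ?thesis using X' by simp
  qed
  also have "\<dots> = ((M\<^sup>2 - M) * X\<^sup>2 + 2 * (M - 1) * X + 2) / ((X - 1)\<^sup>2 * M * (M - 1))
     - (4 * g * X * ((M - 1) * X + 1) * (M + 1)) / ((X - 1)\<^sup>2 * (M - 1) * M\<^sup>2)
     + (2 * g\<^sup>2 * X * ((M - 1) * X\<^sup>2 + 2 * M * X + 1)) / ((X - 1)\<^sup>2 * (M - 1) * M\<^sup>2)"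
  proof -
    have *: "(M * (M - 1) * a - b * (M - 1) + c * (M - 1)) / (Z * (M * (M - 1))\<^sup>2) =
       a / (Z * M * (M - 1)) - b / (Z * (M - 1) * M\<^sup>2) + c / (Z * (M - 1) * M\<^sup>2)" if "Z \<noteq> 0" for a b c Z :: real
    proof -
      \<comment> \<open>Naming M - 1 keeps it an atom while denominators are cleared.\<close>
      define k where "k = M - 1"
      show ?thesis
        using M that unfolding k_def[symmetric] by (simp add: field_simps power2_eq_square)
    qed
    show ?thesis
      unfolding num using X' by (subst *) simp_all
  qed
  also have "\<dots> = kappa2 m r"
  proof -
    have e2: "exp (2 * u) = X\<^sup>2" by (simp add: X_def exp_double)
    \<comment> \<open>Replacing g by u / (X - 1) raises the denominator from the square of X - 1 to
      the cube, and in the g^2 term to the fourth power; this accounts for the exponents in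
      \<open>kappa2\<close>.\<close>
    have "4 * g * X * ((M - 1) * X + 1) * (M + 1) / ((X - 1)\<^sup>2 * (M - 1) * M\<^sup>2) =
        4 * (g * (X - 1)) * X * ((M - 1) * X + 1) * (M + 1) / ((X - 1) ^ 3 * (M - 1) * M\<^sup>2)"
    proof -
      have "a / (Z\<^sup>2 * b * c) = a * Z / (Z ^ 3 * b * c)" if "Z \<noteq> 0" for a b c Z :: real
        using that by (simp add: power3_eq_cube power2_eq_square)
      note this[OF X'(2), of "4 * g * X * ((M - 1) * X + 1) * (M + 1)" "M - 1" "M\<^sup>2"]
      moreover have "4 * g * X * ((M - 1) * X + 1) * (M + 1) * (X - 1) =
          4 * (g * (X - 1)) * X * ((M - 1) * X + 1) * (M + 1)"
        by (simp only: mult_ac)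
      ultimately show ?thesis by (simp only:)
    qed
    moreover have "2 * g\<^sup>2 * X * ((M - 1) * X\<^sup>2 + 2 * M * X + 1) / ((X - 1)\<^sup>2 * (M - 1) * M\<^sup>2) =
        2 * (g * (X - 1))\<^sup>2 * X * ((M - 1) * X\<^sup>2 + 2 * M * X + 1) / ((X - 1) ^ 4 * (M - 1) * M\<^sup>2)"
    proof -
      have "a / (Z\<^sup>2 * b * c) = a * Z\<^sup>2 / (Z ^ 4 * b * c)" if "Z \<noteq> 0" for a b c Z :: real
        using that by (simp add: power4_eq_xxxx power2_eq_square)
      note this[OF X'(2), of "2 * g\<^sup>2 * X * ((M - 1) * X\<^sup>2 + 2 * M * X + 1)" "M - 1" "M\<^sup>2"]
      moreover have "2 * g\<^sup>2 * X * ((M - 1) * X\<^sup>2 + 2 * M * X + 1) * (X - 1)\<^sup>2 =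
          2 * (g * (X - 1))\<^sup>2 * X * ((M - 1) * X\<^sup>2 + 2 * M * X + 1)"
        by (simp only: power_mult_distrib mult_ac)
      ultimately show ?thesis by (simp only:)
    qed
    ultimately show ?thesis
      unfolding kappa2_def Let_def r e2 X_def[symmetric] M_def[symmetric] u_eq[symmetric] by simp
  qed
  finally show ?thesis .
qed

text \<open>Polarization of the norm. It makes the product of the off-diagonal Gram entries equal to
  the product of the diagonal ones times exp (-|z - w|^2).\<close>

lemma hdot_cross: "hdot z w + hdot w z = of_real ((norm z)\<^sup>2 + (norm w)\<^sup>2 - (norm (z - w))\<^sup>2)"
  unfolding of_real_add of_real_diff hdot_self[symmetric]
  by (simp add: hdot_def algebra_simps sum.distrib sum_subtractf)

theorem mainTheorem7:
  fixes z1 z2 :: "complex ^ 'm::finite"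
  assumes "CARD('m) \<ge> 2" and "z1 \<noteq> z2"
  shows "K22_inf_normalized z1 z2 = complex_of_real (kappa2 CARD('m) (norm (z1 - z2)))"
proof -
  define z where "z = (vector [z1, z2] :: complex ^ 'm ^ 2)"
  have z: "z $ 1 = z1" "z $ 2 = z2" by (simp_all add: z_def)
  define w u where "w = z1 - z2" and "u = (norm w)\<^sup>2"
  have w: "w \<noteq> 0" and u: "0 < u" using assms by (simp_all add: w_def u_def)
  define \<alpha> \<beta> x where "\<alpha> = exp ((norm z1)\<^sup>2)" and "\<beta> = exp ((norm z2)\<^sup>2)" and "x = exp (- u)"
  have pos: "0 < \<alpha>" "0 < \<beta>" "0 < x" "x < 1" using u by (simp_all add: \<alpha>_def \<beta>_def x_def)
  define y y' where "y = 1 - u * x / (1 - x)" and "y' = 1 - u / (1 - x)"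
  have y: "0 < y" "x * y'\<^sup>2 \<le> y\<^sup>2"
    using cond_eigenvalue_bounds[OF u] by (simp_all add: x_def y_def y'_def)
  let ?e = "gram z" and ?f = "cond_eigenvalue z"

  have e: "?e 1 1 = of_real \<alpha>" "?e 2 2 = of_real \<beta>"
    by (simp_all only: gram_def z hdot_self \<alpha>_def \<beta>_def exp_of_real)
  have e12: "?e 1 2 * ?e 2 1 = of_real (\<alpha> * \<beta> * x)"
    unfolding gram_def z mult_exp_exp hdot_cross exp_of_real \<alpha>_def \<beta>_def x_def u_def w_def by simp
  have det: "gram_det z = of_real (\<alpha> * \<beta> * (1 - x))"
    by (simp add: gram_det_def e e12 algebra_simps)
  have det_nz: "gram_det z \<noteq> 0" using pos by (simp add: det)
  have f: "?f 1 1 = of_real (\<alpha> * y)" "?f 2 2 = of_real (\<beta> * y)"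
    "?f 1 2 = ?e 1 2 * of_real y'" "?f 2 1 = ?e 2 1 * of_real y'"
    using pos unfolding cond_eigenvalue_def e12 det e z w_def[symmetric] u_def[symmetric]
    by (simp_all add: y_def y'_def)
  have f12: "?f 1 2 * ?f 2 1 = of_real (\<alpha> * \<beta> * (x * y'\<^sup>2))"
  proof -
    have "?f 1 2 * ?f 2 1 = (?e 1 2 * ?e 2 1) * of_real (y'\<^sup>2)"
      by (simp add: f power2_eq_square)
    then show ?thesis by (simp add: e12)
  qed

  have norm_eq: "(cmod a)\<^sup>2 = c" if "a * cnj a = of_real c" for a c
    using that by (simp only: complex_norm_square[symmetric] of_real_eq_iff)
  have factor_e: "\<exists>S :: 2 \<Rightarrow> 2 \<Rightarrow> complex. \<forall>p p'. (\<Sum>r\<in>UNIV. S p r * cnj (S p' r)) = ?e p p'"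
  proof (rule hermitian_2x2_factor[of ?e, OF e])
    have "(cmod (?e 1 2))\<^sup>2 = \<alpha> * \<beta> * x"
      by (rule norm_eq) (simp add: cnj_gram e12)
    then show "(cmod (?e 1 2))\<^sup>2 \<le> \<alpha> * \<beta>" using pos by simp
  qed (simp_all add: cnj_gram pos)
  have factor_f: "\<exists>R :: 2 \<Rightarrow> 2 \<Rightarrow> complex. \<forall>p p'. (\<Sum>r\<in>UNIV. R p r * cnj (R p' r)) = ?f p p'"
  proof (rule hermitian_2x2_factor[of ?f, OF f(1,2)])
    show c: "?f 2 1 = cnj (?f 1 2)" by (simp add: f cnj_gram)
    \<comment> \<open>The matrix \<open>?f\<close> needs a nonnegative determinant. After division
      by \<alpha> \<beta> this is x y'^2 \<le> y^2, the bound that rests on v \<le> sinh v.\<close>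
    have "(cmod (?f 1 2))\<^sup>2 = \<alpha> * \<beta> * (x * y'\<^sup>2)"
      by (rule norm_eq) (simp only: c[symmetric] f12)
    also have "\<dots> \<le> \<alpha> * \<beta> * y\<^sup>2" using y pos by simp
    finally show "(cmod (?f 1 2))\<^sup>2 \<le> \<alpha> * y * (\<beta> * y)" by (simp add: power2_eq_square mult_ac)
  qed (use pos y in simp)
  have \<Lambda>: "matLambda z $ (j, p, q) $ (j', p', q') = of_bool (j = j') * proj_comb w (?e p p') (?f p p') q q'"
    for j p q j' p' q'
    using matLambda_eq[OF det_nz] assms by (simp add: z w_def)
  obtain S :: "2 \<Rightarrow> 2 \<Rightarrow> complex" where S: "(\<Sum>r\<in>UNIV. S p r * cnj (S p' r)) = ?e p p'" for p p'
    using factor_e by blast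
  obtain R :: "2 \<Rightarrow> 2 \<Rightarrow> complex" where R: "(\<Sum>r\<in>UNIV. R p r * cnj (R p' r)) = ?f p p'" for p p'
    using factor_f by blast
  have "complex_gaussian_law (matLambda z) (complex_gaussian (matLambda z))"
    by (rule complex_gaussian_law_proj_comb[OF w \<Lambda> S R])
  note expectation = complex_gaussian_expectation_dets[OF this w \<Lambda>]

  \<comment> \<open>\<open>t\<close> is the trace of a diagonal block with \<alpha> or \<beta>
    removed, and \<tau> the trace of the product of the two off-diagonal blocks with \<alpha>
    \<beta> removed.\<close>
  define M n t \<tau> where "M = real CARD('m)" and "n = M - 1" and "t = n + y" and "\<tau> = n * x + x * y'\<^sup>2"
  define N where "N = (t * t + \<tau>)\<^sup>2 - (n * (t + x)\<^sup>2 + (t * y + x * y'\<^sup>2)\<^sup>2)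
      - (n * (t + x)\<^sup>2 + (t * y + x * y'\<^sup>2)\<^sup>2)
      + ((n + y\<^sup>2) * (n + y\<^sup>2) + 2 * (n * x + y\<^sup>2 * (x * y'\<^sup>2)) + \<tau>\<^sup>2)"
  have card: "of_nat CARD('m) - 1 = complex_of_real n" by (simp add: n_def M_def)
  have comm: "?e 2 1 * ?e 1 2 = of_real (\<alpha> * \<beta> * x)" "?f 2 1 * ?f 1 2 = of_real (\<alpha> * \<beta> * (x * y'\<^sup>2))"
    using e12 f12 by (simp_all add: mult.commute)
  have four: "?e 1 1 * ?e 1 2 * ?e 2 2 * ?e 2 1 = of_real (\<alpha> * \<beta> * (\<alpha> * \<beta> * x))"
    "?f 1 1 * ?f 1 2 * ?f 2 2 * ?f 2 1 = of_real (\<alpha> * y * (\<beta> * y) * (\<alpha> * \<beta> * (x * y'\<^sup>2)))"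
    unfolding of_real_mult[of "\<alpha> * \<beta>" "\<alpha> * \<beta> * x"] of_real_mult[of "\<alpha> * y * (\<beta> * y)"] e12[symmetric] f12[symmetric]
    by (simp_all add: e f(1,2))
  have "(\<integral>a. det (block a 1 ** ctranspose (block a 1)) * det (block a 2 ** ctranspose (block a 2))
        \<partial>complex_gaussian (matLambda z)) = of_real ((\<alpha> * \<beta>)\<^sup>2 * N)"
  proof -
    \<comment> \<open>Every trace is homogeneous in \<alpha> and \<beta>; pulling these factors out
      leaves (\<alpha> \<beta>)^2 in front of each term of the expectation.\<close>
    have "(n * \<alpha> + \<alpha> * y) * (n * \<beta> + \<beta> * y) + \<alpha> * \<beta> * \<tau> = \<alpha> * \<beta> * (t * t + \<tau>)"
      "(n * \<alpha> + \<alpha> * y) * \<beta> + \<alpha> * \<beta> * x = \<alpha> * \<beta> * (t + x)"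
      "(n * \<alpha> + \<alpha> * y) * (\<beta> * y) + \<alpha> * \<beta> * (x * y'\<^sup>2) = \<alpha> * \<beta> * (t * y + x * y'\<^sup>2)"
      "(n * \<beta> + \<beta> * y) * \<alpha> + \<alpha> * \<beta> * x = \<alpha> * \<beta> * (t + x)"
      "(n * \<beta> + \<beta> * y) * (\<alpha> * y) + \<alpha> * \<beta> * (x * y'\<^sup>2) = \<alpha> * \<beta> * (t * y + x * y'\<^sup>2)"
      "n * (\<alpha> * \<beta> * x) + \<alpha> * \<beta> * (x * y'\<^sup>2) = \<alpha> * \<beta> * \<tau>"
      "n * \<alpha>\<^sup>2 + (\<alpha> * y)\<^sup>2 = \<alpha>\<^sup>2 * (n + y\<^sup>2)" "n * \<beta>\<^sup>2 + (\<beta> * y)\<^sup>2 = \<beta>\<^sup>2 * (n + y\<^sup>2)"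
      "n * (\<alpha> * \<beta> * (\<alpha> * \<beta> * x)) + \<alpha> * y * (\<beta> * y) * (\<alpha> * \<beta> * (x * y'\<^sup>2)) = (\<alpha> * \<beta>)\<^sup>2 * (n * x + y\<^sup>2 * (x * y'\<^sup>2))"
      by (simp_all add: t_def \<tau>_def power2_eq_square algebra_simps)
    note real = this
    show ?thesis
      unfolding expectation card e12 f12 comm four unfolding e f(1,2)
        of_real_mult[symmetric] of_real_add[symmetric] of_real_power[symmetric] of_real_diff[symmetric]
        of_real_numeral[symmetric, where 'a=complex] of_real_eq_iff real
      by (simp only: N_def power_mult_distrib) (simp add: algebra_simps)
  qed
  \<comment> \<open>Here (\<alpha> \<beta>)^2 cancels against det A = (\<alpha> \<beta> (1 -
    x))^2.\<close>
  then have "K22_inf z1 z2 = of_real (N / (pi ^ 4 * (1 - x)\<^sup>2))"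
    using pos unfolding K22_inf_def z_def[symmetric] Let_def det_matA[OF det_nz] det
    by (simp add: power_mult_distrib)
  then have "K22_inf_normalized z1 z2 = of_real ((pi\<^sup>2 / (M * (M - 1)))\<^sup>2 * (N / (pi ^ 4 * (1 - x)\<^sup>2)))"
    by (simp add: K22_inf_normalized_def M_def)
  also have "(pi\<^sup>2 / (M * (M - 1)))\<^sup>2 * (N / (pi ^ 4 * (1 - x)\<^sup>2)) = N / ((1 - x)\<^sup>2 * (M * (M - 1))\<^sup>2)"
    by (simp add: power_divide)
  also have "\<dots> = kappa2 CARD('m) (norm (z1 - z2))"
    unfolding N_def \<tau>_def t_def n_def M_def y_def y'_def x_def
    by (rule kappa2_eq[OF assms(1) u]) (simp add: u_def w_def)
  finally show ?thesis .
qed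

end
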